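(* Let $G$ be a bipartite graph with $m$ left vertices and $n$ right vertices. Then for all $k_1,\dots,k_m\in\mathbb Z_{\ge0}$, $$|Q_G(k_1,\dots,k_m)\cap\mathbb Z^n|=\sum_{\boldsymbol a\in D(G)}\prod_{i=1}^m c(a_i,k_i),$$ where, for all $k\in\mathbb Z_{\ge0}$, $c(0,k)=1$ and $$c(a,k)=\sum_{r=1}^{\min(a,k)}2^r\binom{k}{r}\binom{a-1}{r-1}\quad\text{for } a\ge1.$$
   Context: $G$ is a bipartite graph with left vertices $\ell_1,\dots,\ell_m$ and right vertices $r_1,\dots,r_n$; $I_j=\{i\in[n]\mid\ell_j\text{ is adjacent to }r_i\}$ for $j\in[m]$. A $G$-draconian sequence is a sequence $(a_1,\dots,a_m)$ of nonnegative integers such that $\sum_{i\in J}a_i\le|\bigcup_{i\in J}I_i|$ for every nonempty $J\subset[m]$; $D(G)$ is the set of all of them. For nonempty $I\subset[n]$, $\diamondsuit_I=\operatorname{conv}(\pm\boldsymbol e_i\mid i\in I)\subset\mathbb R^n$ is the cross polytope, and $\diamondsuit_\varnothing=\{\boldsymbol 0\}$. $Q_G(k_1,\dots,k_m)=k_1\diamondsuit_{I_1}+\cdots+k_m\diamondsuit_{I_m}$ (Minkowski sum). *)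

theory Defs
  imports "HOL-Analysis.Analysis" "HOL-Library.Set_Algebras" "HOL-Library.FuncSet"
begin

text \<open>
  A bipartite graph with left vertices \<open>{1..m}\<close> and right vertices the elements of a finite
  type \<open>'n\<close> (so that \<open>n = CARD('n)\<close>) is given by its set of edges
  \<open>E \<subseteq> {1..m} \<times> UNIV\<close>, each edge being written as (left end, right end).
\<close>

definition bipartite_graph :: "nat \<Rightarrow> (nat \<times> 'n) set \<Rightarrow> bool" where
  "bipartite_graph m E \<longleftrightarrow> E \<subseteq> {1..m} \<times> UNIV"

definition nbhd :: "(nat \<times> 'n) set \<Rightarrow> nat \<Rightarrow> 'n set" where
  "nbhd E j = {i. (j, i) \<in> E}"

text \<open>
  Sequences \<open>(a\<^sub>1, \<dots>, a\<^sub>m)\<close> are extensional functions on \<open>{1..m}\<close>, so that distinct elements of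
  the set below are distinct sequences.
\<close>

definition draconian :: "nat \<Rightarrow> (nat \<times> 'n) set \<Rightarrow> (nat \<Rightarrow> nat) set" where
  "draconian m E =
     {a \<in> {1..m} \<rightarrow>\<^sub>E UNIV.
        \<forall>J. J \<noteq> {} \<and> J \<subseteq> {1..m} \<longrightarrow> (\<Sum>j\<in>J. a j) \<le> card (\<Union>j\<in>J. nbhd E j)}"

text \<open>The case distinction is needed because the convex hull of the empty set is empty.\<close>

definition cross_polytope :: "'n::finite set \<Rightarrow> (real ^ 'n) set" where
  "cross_polytope I =
     (if I = {} then {0}
      else convex hull ((\<lambda>i. axis i 1) ` I \<union> (\<lambda>i. - axis i 1) ` I))"

text \<open>The sum below is the Minkowski sum of sets from \<open>Set_Algebras\<close>.\<close>

definition Q_polytope :: "nat \<Rightarrow> (nat \<times> 'n::finite) set \<Rightarrow> (nat \<Rightarrow> nat) \<Rightarrow> (real ^ 'n) set" where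
  "Q_polytope m E k = (\<Sum>j\<in>{1..m}. (\<lambda>x. real (k j) *\<^sub>R x) ` cross_polytope (nbhd E j))"

definition integer_points :: "(real ^ 'n) set" where
  "integer_points = {x. \<forall>i. x $ i \<in> \<int>}"

definition c_coeff :: "nat \<Rightarrow> nat \<Rightarrow> nat" where
  "c_coeff a k = (if a = 0 then 1
            else (\<Sum>r = 1..min a k. 2 ^ r * (k choose r) * ((a - 1) choose (r - 1))))"

end

(*
  Replacing each left vertex j by k j copies turns both sides into weighted counts of Hall
  vectors: c(a, k) is the sum of 2^|supp u| over the u in N^k with sum a, and an integer
  point x lies in Q exactly when |x| satisfies the Hall inequalities on the right-hand side.
  The theorem becomes the symmetry between left and right of the sum of 2^|supp w| over
  Hall vectors w.

  For that, the Hall vectors with support exactly J are equinumerous with the sets T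
  of right vertices with |T| = |J| that satisfy Hall's condition together with J, a relation
  symmetric in J and T.  Indeed, take a generic affine hyperplane arrangement in R^J whose
  i-th normal is supported on the neighbours of i.  Its vertices are indexed by these T, and the
  monomials x^(w - 1) interpolate uniquely on the vertices: products of the hyperplane equations
  separate the vertices, and a combination of the monomials that vanishes at all vertices vanishes
  on all flats, by induction on their dimension, because along every line its degree is smaller
  than the number of hyperplanes that cross the line.
*)

theory Submission
  imports Defs "HOL-Computational_Algebra.Polynomial"
begin

section \<open>Linear algebra\<close>

text \<open>No bijection between Hall vectors and Hall pairs is evident, so both are counted through
  dimensions: vectors index monomials, pairs index points, and each inequality between the counts is
  a separate linear-algebra argument. The exponent \<open>w - 1\<close> is what a vertex leaves
  over: it uses |J| hyperplanes, and multiplying out the remaining equations yields only monomials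
  x^e with e + 1 a Hall vector. The same shift makes the count along lines strict: if a direction
  has support K, the degree is at most |N(K)| - |K|, while genericity lets fewer than |K| of the
  neighbours of K be parallel to it. The powers of 2 have different origins: signs of the nonzero
  coordinates of a lattice point on one side, the factor 2^r in c(a, k) on the other, where r counts
  the nonzero parts of a weak composition. The duality therefore has to respect support sizes, not
  merely the number of Hall vectors.\<close>

lemma homogeneous_system_nontrivial_solution:
  fixes M :: "'a \<Rightarrow> 'b \<Rightarrow> real"
  assumes "finite B" "finite A" "card B < card A"
  shows "\<exists>c. (\<exists>a\<in>A. c a \<noteq> 0) \<and> (\<forall>a. a \<notin> A \<longrightarrow> c a = 0) \<and> (\<forall>b\<in>B. (\<Sum>a\<in>A. M a b * c a) = 0)"
  using assms
proof (induction B arbitrary: A M rule: finite_induct)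
  case empty
  then obtain a where "a \<in> A" by (metis card.empty card_gt_0_iff equals0I)
  then show ?case by (intro exI[of _ "\<lambda>x. if x = a then 1 else 0"]) auto
next
  case (insert b B)
  show ?case
  proof (cases "\<forall>a\<in>A. M a b = 0")
    case True
    have "card B < card A" using insert by simp
    then obtain c where "\<exists>a\<in>A. c a \<noteq> 0" "\<forall>a. a \<notin> A \<longrightarrow> c a = 0"
      "\<forall>b\<in>B. (\<Sum>a\<in>A. M a b * c a) = 0"
      using insert.IH[OF insert.prems(1), of M] by blast
    then show ?thesis using True by (intro exI[of _ c]) auto
  next
    case False
    then obtain a0 where a0: "a0 \<in> A" "M a0 b \<noteq> 0" by blast
    let ?A = "A - {a0}"
    \<comment> \<open>Gaussian elimination: equation \<open>b\<close> is solved for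
      \<open>a0\<close> and substituted into the others; \<open>d\<close> below restores that
      unknown.\<close>
    let ?M = "\<lambda>a b'. M a b' - M a0 b' * M a b / M a0 b"
    have "finite ?A" "card B < card ?A" using insert a0 by auto
    from insert.IH[OF this, of ?M] obtain c where c: "\<exists>a\<in>?A. c a \<noteq> 0"
      "\<forall>a. a \<notin> ?A \<longrightarrow> c a = 0" "\<forall>b\<in>B. (\<Sum>a\<in>?A. ?M a b * c a) = 0"
      by (elim exE conjE) (rule that)
    define s where "s = (\<Sum>a\<in>?A. M a b * c a)"
    define d where "d = c(a0 := - s / M a0 b)"
    have split: "(\<Sum>a\<in>A. M a b' * d a) = (\<Sum>a\<in>?A. M a b' * c a) - M a0 b' * s / M a0 b" for b'
      using insert.prems a0 by (simp add: sum.remove[of A a0] d_def)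
    have "(\<Sum>a\<in>A. M a b' * d a) = 0" if "b' \<in> insert b B" for b'
    proof (cases "b' = b")
      case True
      then show ?thesis using a0 by (simp add: split s_def)
    next
      case False
      then have "0 = (\<Sum>a\<in>?A. ?M a b' * c a)" using that c(3) by simp
      also have "\<dots> = (\<Sum>a\<in>?A. M a b' * c a - M a0 b' / M a0 b * (M a b * c a))"
        by (rule sum.cong) (simp_all add: algebra_simps)
      also have "\<dots> = (\<Sum>a\<in>?A. M a b' * c a) - M a0 b' * s / M a0 b"
        unfolding sum_subtractf sum_distrib_left[symmetric] s_def by simp
      finally show ?thesis by (simp add: split)
    qed
    moreover have "\<exists>a\<in>A. d a \<noteq> 0" "\<forall>a. a \<notin> A \<longrightarrow> d a = 0" using c a0 by (auto simp: d_def)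
    ultimately show ?thesis by blast
  qed
qed

text \<open>Start at a vector good for the old functionals and move in a direction good for the new
  one: each functional vanishes for at most one parameter. Closure under such moves is all that is
  asked of \<open>V\<close>, so the lemma serves both for coefficients of a matrix and for the
  directions of a flat.\<close>

lemma avoid_finitely_many_hyperplanes:
  fixes V :: "('a \<Rightarrow> real) set" and G :: "(('a \<Rightarrow> real) \<Rightarrow> real) set"
  assumes "finite G" "V \<noteq> {}"
    and closed: "\<And>u v t. u \<in> V \<Longrightarrow> v \<in> V \<Longrightarrow> (\<lambda>a. u a + t * v a) \<in> V"
    and lin: "\<And>g u v t. g \<in> G \<Longrightarrow> g (\<lambda>a. u a + t * v a) = g u + t * g v"
    and nonzero: "\<And>g. g \<in> G \<Longrightarrow> \<exists>v\<in>V. g v \<noteq> 0"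
  shows "\<exists>v\<in>V. \<forall>g\<in>G. g v \<noteq> 0"
  using assms(1) lin nonzero
proof (induction G rule: finite_induct)
  case empty
  then show ?case using assms(2) by auto
next
  case (insert g G)
  then obtain v where v: "v \<in> V" "\<forall>g\<in>G. g v \<noteq> 0" by (metis insertCI)
  obtain v' where v': "v' \<in> V" "g v' \<noteq> 0" using insert.prems(2) by blast
  \<comment> \<open>If \<open>h v' = 0\<close>, division by zero merely forbids the parameter 0;
    such an \<open>h\<close> is constant and nonzero along the line.\<close>
  define Bad where "Bad = (\<lambda>h. - h v / h v') ` insert g G"
  have "finite Bad" using insert by (simp add: Bad_def)
  then obtain t where t: "t \<notin> Bad" using ex_new_if_finite infinite_UNIV_char_0 by blast
  have "h (\<lambda>a. v a + t * v' a) \<noteq> 0" if h: "h \<in> insert g G" for h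
  proof
    assume "h (\<lambda>a. v a + t * v' a) = 0"
    then have *: "h v + t * h v' = 0" using insert.prems(1)[OF h] by simp
    show False
    proof (cases "h v' = 0")
      case True
      then show False using * h v v' by auto
    next
      case False
      then have "t = - h v / h v'" using * by (simp add: field_simps)
      then show False using t h by (auto simp: Bad_def)
    qed
  qed
  then show ?case using closed[OF v(1) v'(1)] by blast
qed

text \<open>Dedekind's argument: monomial functions are pairwise distinct multiplicative characters.\<close>

lemma monomials_linearly_independent:
  fixes c :: "('l \<Rightarrow> nat) \<Rightarrow> real"
  assumes "finite J" "finite W" "W \<subseteq> extensional J"
    and "\<And>x. (\<Sum>w\<in>W. c w * (\<Prod>j\<in>J. x j ^ w j)) = 0"
    and "w \<in> W"
  shows "c w = 0"
  using assms(2-5)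
proof (induction W arbitrary: c w rule: finite_induct)
  case empty
  then show ?case by simp
next
  case (insert v W)
  define ch where "ch w x = (\<Prod>j\<in>J. x j ^ w j)" for w :: "'l \<Rightarrow> nat" and x :: "'l \<Rightarrow> real"
  have mult: "ch w (\<lambda>j. x j * y j) = ch w x * ch w y" for w x y
    by (simp add: ch_def power_mult_distrib prod.distrib)
  have zero: "(\<Sum>w\<in>insert v W. c w * ch w x) = 0" for x
    using insert.prems(2) by (simp add: ch_def)
  \<comment> \<open>Subtracting \<open>ch v y\<close> times the relation from its translate by
    \<open>y\<close> cancels the term of \<open>v\<close>.\<close>
  have *: "(c w * (ch w y - ch v y)) = 0" if "w \<in> W" for w y
  proof (rule insert.IH[of "\<lambda>w. c w * (ch w y - ch v y)"])
    fix x
    have "(\<Sum>w\<in>W. c w * (ch w y - ch v y) * (\<Prod>j\<in>J. x j ^ w j))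
       = (\<Sum>w\<in>insert v W. c w * (ch w y - ch v y) * ch w x)"
      using insert.hyps by (simp add: ch_def)
    also have "\<dots> = (\<Sum>w\<in>insert v W. c w * ch w (\<lambda>j. x j * y j)) - ch v y * (\<Sum>w\<in>insert v W. c w * ch w x)"
      unfolding mult sum_distrib_left sum_subtractf[symmetric]
      by (rule sum.cong) (auto simp: algebra_simps)
    finally show "(\<Sum>w\<in>W. c w * (ch w y - ch v y) * (\<Prod>j\<in>J. x j ^ w j)) = 0"
      by (simp add: zero)
  qed (use insert.prems that in auto)
  have cW: "c w = 0" if w: "w \<in> W" for w
  proof -
    have "w \<noteq> v" using w insert.hyps by auto
    then obtain j where j: "j \<in> J" "w j \<noteq> v j"
      using w insert.prems(1) extensionalityI[of w J v] by blast
    have "ch u (\<lambda>i. if i = j then 2 else 1) = 2 ^ u j" for u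
      unfolding ch_def using j assms(1) by (simp add: if_distrib[of "\<lambda>a. a ^ _"] cong: if_cong)
    then have "ch w (\<lambda>i. if i = j then 2 else 1) \<noteq> ch v (\<lambda>i. if i = j then 2 else 1)"
      using j by simp
    then show ?thesis using *[OF w] by (metis mult_eq_0_iff right_minus_eq)
  qed
  have "c v = 0" using zero[of "\<lambda>_. 1"] insert.hyps cW by (simp add: ch_def)
  then show ?case using cW insert.prems by auto
qed

section \<open>Generic matrices supported on a bipartite graph\<close>

definition neighbours :: "('l \<Rightarrow> 'r \<Rightarrow> bool) \<Rightarrow> 'r set \<Rightarrow> 'l set \<Rightarrow> 'r set" where
  "neighbours E R K = {i \<in> R. \<exists>j\<in>K. E j i}"

text \<open>General position expressed through supports of vectors rather than minors. Only
  neighbours of \<open>K\<close> are counted, because the other equations hold trivially for a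
  vector supported on \<open>K\<close>.\<close>

definition generic_matrix :: "('l \<Rightarrow> 'r \<Rightarrow> bool) \<Rightarrow> 'l set \<Rightarrow> 'r set \<Rightarrow> ('l \<Rightarrow> 'r \<Rightarrow> real) \<Rightarrow> bool" where
  "generic_matrix E J R A \<longleftrightarrow>
     (\<forall>j i. \<not> E j i \<longrightarrow> A j i = 0) \<and>
     (\<forall>u K. K = {j \<in> J. u j \<noteq> 0} \<and> K \<noteq> {} \<longrightarrow>
        card {i \<in> neighbours E R K. (\<Sum>j\<in>J. A j i * u j) = 0} < card K)"

lemma finite_neighbours [simp]: "finite R \<Longrightarrow> finite (neighbours E R K)"
  by (simp add: neighbours_def)

lemma generic_matrixD:
  assumes "generic_matrix E J R A" "K = {j \<in> J. u j \<noteq> 0}" "K \<noteq> {}"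
  shows "card {i \<in> neighbours E R K. (\<Sum>j\<in>J. A j i * u j) = 0} < card K"
  using assms unfolding generic_matrix_def by blast

text \<open>If \<open>u\<close> and \<open>v\<close> were not proportional, a combination of them would vanish exactly off a
  proper part \<open>K'\<close> of the support \<open>K\<close>; applying genericity to it and to the restriction of \<open>u\<close> to
  \<open>K - K'\<close> leaves room for at most \<open>card K - 2\<close> equations.\<close>

lemma generic_kernel_proportional:
  assumes gen: "generic_matrix E J R A" and fin: "finite J" "finite R"
    and K: "K = {j \<in> J. u j \<noteq> 0}" "K = {j \<in> J. v j \<noteq> 0}" "K \<noteq> {}"
    and S: "S \<subseteq> neighbours E R K" "card S = card K - 1"
    and u: "\<And>i. i \<in> S \<Longrightarrow> (\<Sum>j\<in>J. A j i * u j) = 0"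
    and v: "\<And>i. i \<in> S \<Longrightarrow> (\<Sum>j\<in>J. A j i * v j) = 0"
  shows "\<exists>c. c \<noteq> 0 \<and> (\<forall>j\<in>J. u j = c * v j)"
proof -
  obtain j0 where j0: "j0 \<in> K" using K(3) by blast
  define z where "z j = v j0 * u j - u j0 * v j" for j
  define K' where "K' = {j \<in> J. z j \<noteq> 0}"
  have fK: "finite K" and finS: "finite S"
    using fin K(1) finite_subset[OF S(1)] by auto
  have nz: "u j0 \<noteq> 0" "v j0 \<noteq> 0" using j0 K by blast+
  have out: "u j = 0" "v j = 0" if "j \<in> J" "j \<notin> K" for j
    using that K(1,2) by blast+
  have K'sub: "K' \<subseteq> K" using out by (fastforce simp: K'_def z_def)
  have j0': "j0 \<notin> K'" by (simp add: K'_def z_def)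
  have "K' = {}"
  proof (rule ccontr)
    assume "K' \<noteq> {}"
    then have c1: "card {i \<in> neighbours E R K'. (\<Sum>j\<in>J. A j i * z j) = 0} < card K'"
      using generic_matrixD[OF gen K'_def] by simp
    define t where "t j = (if j \<in> K - K' then u j else 0)" for j
    have Kt: "K - K' = {j \<in> J. t j \<noteq> 0}" using K(1) by (auto simp: t_def)
    have "K - K' \<noteq> {}" using j0 j0' by blast
    then have c2: "card {i \<in> neighbours E R (K - K'). (\<Sum>j\<in>J. A j i * t j) = 0} < card (K - K')"
      using generic_matrixD[OF gen Kt] by simp
    have "S \<inter> neighbours E R K' \<subseteq> {i \<in> neighbours E R K'. (\<Sum>j\<in>J. A j i * z j) = 0}"
    proof
      fix i assume i: "i \<in> S \<inter> neighbours E R K'"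
      have "(\<Sum>j\<in>J. A j i * z j) = v j0 * (\<Sum>j\<in>J. A j i * u j) - u j0 * (\<Sum>j\<in>J. A j i * v j)"
        unfolding sum_distrib_left sum_subtractf[symmetric]
        by (rule sum.cong) (simp_all add: z_def algebra_simps)
      then show "i \<in> {i \<in> neighbours E R K'. (\<Sum>j\<in>J. A j i * z j) = 0}"
        using i u v by auto
    qed
    then have d1: "card (S \<inter> neighbours E R K') < card K'"
      by (rule le_less_trans[OF card_mono c1, rotated]) (simp add: fin)
    \<comment> \<open>These equations have no coefficient on \<open>K'\<close>, so dropping the
      entries of \<open>u\<close> there does not change them.\<close>
    have "S - neighbours E R K' \<subseteq> {i \<in> neighbours E R (K - K'). (\<Sum>j\<in>J. A j i * t j) = 0}"
    proof
      fix i assume i: "i \<in> S - neighbours E R K'"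
      then have iR: "i \<in> R" "\<exists>j\<in>K. E j i" "\<forall>j\<in>K'. \<not> E j i" using S by (auto simp: neighbours_def)
      have "A j i * t j = A j i * u j" if "j \<in> J" for j
        using that iR(3) gen out(1)[of j] by (auto simp: t_def generic_matrix_def)
      then have "(\<Sum>j\<in>J. A j i * t j) = (\<Sum>j\<in>J. A j i * u j)" by (rule sum.cong[OF refl])
      then show "i \<in> {i \<in> neighbours E R (K - K'). (\<Sum>j\<in>J. A j i * t j) = 0}"
        using i u iR by (auto simp: neighbours_def)
    qed
    then have d2: "card (S - neighbours E R K') < card (K - K')"
      by (rule le_less_trans[OF card_mono c2, rotated]) (simp add: fin)
    have "card S = card (S \<inter> neighbours E R K') + card (S - neighbours E R K')"
      using finS by (metis card_Int_Diff)
    moreover have "card K = card K' + card (K - K')"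
      using fK K'sub by (metis card_Diff_subset card_mono finite_subset le_add_diff_inverse)
    ultimately show False using d1 d2 S(2) by linarith
  qed
  then have "u j = u j0 / v j0 * v j" if "j \<in> J" for j
    using that nz by (auto simp: K'_def z_def field_simps)
  then show ?thesis using nz by (intro exI[of _ "u j0 / v j0"]) auto
qed

text \<open>Right vertices are added one at a time. A new one can break the bound only for a
  \<open>u\<close> that already satisfies \<open>card K - 1\<close> equations, and up to scaling
  there is one such \<open>u\<close> for each support \<open>K\<close> and equation set
  \<open>S\<close>. The new coefficients thus have to avoid only finitely many hyperplanes.\<close>

lemma generic_matrix_exists:
  fixes J :: "'l set" and R :: "'r set"
  assumes "finite R" "finite J"
  shows "\<exists>A. generic_matrix E J R A"
  using assms(1)
proof (induction R rule: finite_induct)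
  case empty
  have "generic_matrix E J {} (\<lambda>_ _. 0)"
    unfolding generic_matrix_def neighbours_def using assms(2)
    by (auto simp: card_gt_0_iff)
  then show ?case by blast
next
  case (insert i0 R)
  then obtain A where A: "generic_matrix E J R A" by blast
  define crit where "crit K S u \<longleftrightarrow> K = {j \<in> J. u j \<noteq> 0} \<and> card S = card K - 1 \<and> S \<subseteq> neighbours E R K \<and>
      (\<forall>i\<in>S. (\<Sum>j\<in>J. A j i * u j) = 0)" for K S and u :: "'l \<Rightarrow> real"
  define sol where "sol K S = (SOME u. crit K S u)" for K S
  define P where "P = {(K, S). K \<subseteq> J \<and> S \<subseteq> R \<and> (\<exists>j\<in>K. E j i0) \<and> (\<exists>u. crit K S u)}"
  define G where "G = (\<lambda>(K, S) a. (\<Sum>j\<in>J. (if E j i0 then a j else 0) * sol K S j)) ` P"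
  have "finite P"
    by (rule finite_subset[of _ "Pow J \<times> Pow R"]) (use insert assms in \<open>auto simp: P_def\<close>)
  have "\<exists>a\<in>UNIV. \<forall>g\<in>G. g a \<noteq> 0"
  proof (rule avoid_finitely_many_hyperplanes)
    show "finite G" using \<open>finite P\<close> by (simp add: G_def)
    show "g (\<lambda>a. u a + t * v a) = g u + t * g v" if "g \<in> G" for g u v t
    proof -
      obtain K S where g: "g = (\<lambda>a. (\<Sum>j\<in>J. (if E j i0 then a j else 0) * sol K S j))"
        using \<open>g \<in> G\<close> by (auto simp: G_def)
      show ?thesis unfolding g sum_distrib_left sum.distrib[symmetric]
        by (rule sum.cong) (simp_all add: algebra_simps)
    qed
    show "\<exists>v\<in>UNIV. g v \<noteq> 0" if g: "g \<in> G" for g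
    proof -
      obtain K S where KS: "(K, S) \<in> P" and g: "g = (\<lambda>a. (\<Sum>j\<in>J. (if E j i0 then a j else 0) * sol K S j))"
        using g by (auto simp: G_def)
      obtain j where j: "j \<in> K" "E j i0" "K \<subseteq> J" using KS by (auto simp: P_def)
      have "crit K S (sol K S)" unfolding sol_def using KS someI_ex[of "crit K S"] by (auto simp: P_def)
      then have "sol K S j \<noteq> 0" using j by (auto simp: crit_def)
      moreover have "g (\<lambda>x. if x = j then 1 else 0) = sol K S j"
      proof -
        have "g (\<lambda>x. if x = j then 1 else 0) = (\<Sum>x\<in>J. if x = j then sol K S x else 0)"
          unfolding g by (rule sum.cong) (use j in auto)
        then show ?thesis using j assms(2) by auto
      qed
      ultimately show ?thesis by (intro bexI[of _ "\<lambda>x. if x = j then 1 else 0"]) auto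
    qed
  qed auto
  then obtain a where a: "\<And>g. g \<in> G \<Longrightarrow> g a \<noteq> 0" by auto
  define A' where "A' j i = (if i = i0 then if E j i0 then a j else 0 else A j i)" for j i
  have "generic_matrix E J (insert i0 R) A'"
    unfolding generic_matrix_def
  proof (intro conjI allI impI)
    show "A' j i = 0" if "\<not> E j i" for j i
      using that A by (auto simp: A'_def generic_matrix_def)
    fix u :: "'l \<Rightarrow> real" and K
    assume K: "K = {j \<in> J. u j \<noteq> 0} \<and> K \<noteq> {}"
    define S where "S = {i \<in> neighbours E R K. (\<Sum>j\<in>J. A j i * u j) = 0}"
    have S: "card S < card K" unfolding S_def using generic_matrixD[OF A] K by blast
    have fS: "finite S" using insert.hyps by (simp add: S_def)
    have R0: "(\<Sum>j\<in>J. A' j i * u j) = (\<Sum>j\<in>J. A j i * u j)" if "i \<in> R" for i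
      using that insert.hyps by (intro sum.cong) (auto simp: A'_def)
    let ?T = "{i \<in> neighbours E (insert i0 R) K. (\<Sum>j\<in>J. A' j i * u j) = 0}"
    have sub: "?T \<subseteq> insert i0 S" using R0 by (auto simp: neighbours_def S_def)
    show "card ?T < card K"
    proof (cases "i0 \<in> ?T \<and> card S = card K - 1")
      case False
      then consider "i0 \<notin> ?T" | "card S < card K - 1" using S by linarith
      then show ?thesis
      proof cases
        case 1
        then have "?T \<subseteq> S" using sub by blast
        then show ?thesis using S fS by (meson card_mono le_less_trans)
      next
        case 2
        have "card ?T \<le> card (insert i0 S)" using sub fS by (intro card_mono) auto
        also have "\<dots> \<le> Suc (card S)" by (simp add: card_insert_le_m1 fS card_insert_if)
        finally show ?thesis using 2 by linarith
      qed
    next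
      case True
      have cr: "crit K S u" using True K by (auto simp: crit_def S_def)
      then have cs: "crit K S (sol K S)" using someI[of "crit K S" u] by (simp add: sol_def)
      have "(K, S) \<in> P" using cr True K by (auto simp: P_def S_def neighbours_def)
      then have g: "(\<Sum>j\<in>J. (if E j i0 then a j else 0) * sol K S j) \<noteq> 0"
        using a unfolding G_def by blast
      obtain c where c: "c \<noteq> 0" "\<forall>j\<in>J. u j = c * sol K S j"
        using generic_kernel_proportional[OF A assms(2) insert.hyps(1), of K u "sol K S" S] cr cs K
        unfolding crit_def by blast
      have "(\<Sum>j\<in>J. A' j i0 * u j) = c * (\<Sum>j\<in>J. (if E j i0 then a j else 0) * sol K S j)"
        unfolding sum_distrib_left by (rule sum.cong) (use c in \<open>auto simp: A'_def\<close>)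
      then show ?thesis using True g c by auto
    qed
  qed
  then show ?case by blast
qed

section \<open>Hall vectors and generic affine arrangements\<close>

definition hall_vectors :: "('l \<Rightarrow> 'r \<Rightarrow> bool) \<Rightarrow> 'l set \<Rightarrow> 'r set \<Rightarrow> ('l \<Rightarrow> nat) set" where
  "hall_vectors E L R = {w \<in> L \<rightarrow>\<^sub>E UNIV. \<forall>K\<subseteq>L. sum w K \<le> card (neighbours E R K)}"

definition positive_hall_vectors :: "('l \<Rightarrow> 'r \<Rightarrow> bool) \<Rightarrow> 'l set \<Rightarrow> 'r set \<Rightarrow> ('l \<Rightarrow> nat) set" where
  "positive_hall_vectors E L R = {w \<in> hall_vectors E L R. \<forall>j\<in>L. 0 < w j}"

text \<open>For finite sets this is, by Hall's marriage theorem, the existence of a perfect matching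
  between \<open>J\<close> and \<open>T\<close>. The counting form is what the linear algebra uses
  and delivers.\<close>

definition hall_pair :: "('l \<Rightarrow> 'r \<Rightarrow> bool) \<Rightarrow> 'l set \<Rightarrow> 'r set \<Rightarrow> bool" where
  "hall_pair E J T \<longleftrightarrow> card J = card T \<and> (\<forall>K\<subseteq>J. card K \<le> card (neighbours E T K))"

lemma neighbours_empty [simp]: "neighbours E R {} = {}"
  by (simp add: neighbours_def)

lemma finite_hall_vectors:
  assumes "finite L" "finite R"
  shows "finite (hall_vectors E L R)"
proof (rule finite_subset)
  show "finite (L \<rightarrow>\<^sub>E {..card R})" using assms by (simp add: finite_PiE)
  show "hall_vectors E L R \<subseteq> L \<rightarrow>\<^sub>E {..card R}"
  proof
    fix w assume w: "w \<in> hall_vectors E L R"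
    have "w j \<le> card R" if "j \<in> L" for j
    proof -
      have "sum w {j} \<le> card (neighbours E R {j})"
        using w that unfolding hall_vectors_def by blast
      also have "\<dots> \<le> card R" using assms by (intro card_mono) (auto simp: neighbours_def)
      finally show ?thesis by simp
    qed
    then show "w \<in> L \<rightarrow>\<^sub>E {..card R}" using w by (auto simp: hall_vectors_def)
  qed
qed

lemma finite_positive_hall_vectors:
  "finite L \<Longrightarrow> finite R \<Longrightarrow> finite (positive_hall_vectors E L R)"
  by (simp add: positive_hall_vectors_def finite_hall_vectors)

section \<open>Vertices of a generic affine arrangement\<close>

locale generic_arrangement =
  fixes E :: "'l \<Rightarrow> 'r \<Rightarrow> bool" and J :: "'l set" and R :: "'r set"
    and A :: "'l \<Rightarrow> 'r \<Rightarrow> real" and b :: "'r \<Rightarrow> real"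
  assumes finJ: "finite J" and finR: "finite R"
    and gen: "generic_matrix E J R A"
    and few_at_point: "card {i \<in> R. (\<Sum>j\<in>J. A j i * x j) = b i} \<le> card J"
begin

definition form :: "'r \<Rightarrow> ('l \<Rightarrow> real) \<Rightarrow> real" where
  "form i u = (\<Sum>j\<in>J. A j i * u j)"

definition planes_at :: "('l \<Rightarrow> real) \<Rightarrow> 'r set" where
  "planes_at x = {i \<in> R. form i x = b i}"

definition shifted_monomial :: "('l \<Rightarrow> nat) \<Rightarrow> ('l \<Rightarrow> real) \<Rightarrow> real" where
  "shifted_monomial w x = (\<Prod>j\<in>J. x j ^ (w j - 1))"

lemma card_planes_at: "card (planes_at x) \<le> card J"
  using few_at_point by (simp add: planes_at_def form_def)

lemma planes_at_subset: "planes_at x \<subseteq> R"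
  by (auto simp: planes_at_def)

lemma finite_planes_at [simp]: "finite (planes_at x)"
  using finite_subset[OF planes_at_subset finR] .

lemma form_line: "form i (\<lambda>j. u j + t * v j) = form i u + t * form i v"
  unfolding form_def sum_distrib_left sum.distrib[symmetric]
  by (rule sum.cong) (simp_all add: algebra_simps)

lemma A_zero: "\<not> E j i \<Longrightarrow> A j i = 0"
  using gen by (simp add: generic_matrix_def)

lemma card_form_zero:
  assumes "j \<in> J" "u j \<noteq> 0"
  shows "card {i \<in> neighbours E R {j \<in> J. u j \<noteq> 0}. form i u = 0} < card {j \<in> J. u j \<noteq> 0}"
  unfolding form_def by (rule generic_matrixD[OF gen refl]) (use assms in auto)

lemma form_nonneighbour: "i \<in> R \<Longrightarrow> i \<notin> neighbours E R {j \<in> J. u j \<noteq> 0} \<Longrightarrow> form i u = 0"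
  unfolding form_def neighbours_def by (rule sum.neutral) (auto simp: A_zero)

text \<open>Hall's condition puts at least \<open>card K\<close> equations of \<open>T\<close> among
  the neighbours of the support \<open>K\<close> of \<open>u\<close>, whereas genericity allows
  fewer than \<open>card K\<close> of them to hold.\<close>

lemma kernel_hall_pair:
  assumes "hall_pair E J T" "T \<subseteq> R" "\<And>i. i \<in> T \<Longrightarrow> form i u = 0" "j \<in> J"
  shows "u j = 0"
proof (rule ccontr)
  assume uj: "u j \<noteq> 0"
  define K where "K = {j \<in> J. u j \<noteq> 0}"
  have "card K \<le> card (neighbours E T K)" using assms(1) by (auto simp: hall_pair_def K_def)
  also have "\<dots> \<le> card {i \<in> neighbours E R K. form i u = 0}"
    using assms finR by (intro card_mono) (auto simp: neighbours_def)
  also have "\<dots> < card K" using card_form_zero[of j u] assms(4) uj by (simp add: K_def)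
  finally show False by simp
qed

text \<open>Homogenise: the unknown \<open>None\<close> multiplies \<open>- b i\<close>, giving one
  unknown more than equations. A solution with zero at \<open>None\<close> would lie in the trivial
  kernel, so the solution scales to an affine point, and general position leaves no room for further
  hyperplanes through it.\<close>

lemma vertex_exists:
  assumes T: "hall_pair E J T" "T \<subseteq> R"
  shows "\<exists>x. planes_at x = T"
proof -
  have finT: "finite T" using T finR finite_subset by blast
  let ?M = "\<lambda>q i. case q of None \<Rightarrow> - b i | Some j \<Rightarrow> A j i"
  let ?A = "insert None (Some ` J)"
  have "card ?A = Suc (card J)" using finJ by (simp add: card_image)
  then have "card T < card ?A" using T by (simp add: hall_pair_def)
  from homogeneous_system_nontrivial_solution[OF finT _ this, of ?M]
  obtain c where c: "\<exists>q\<in>?A. c q \<noteq> 0" "\<And>i. i \<in> T \<Longrightarrow> (\<Sum>q\<in>?A. ?M q i * c q) = 0"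
    using finJ by auto
  have sum_eq: "(\<Sum>q\<in>?A. ?M q i * c q) = form i (\<lambda>j. c (Some j)) - b i * c None" for i
    using finJ by (simp add: form_def sum.reindex)
  have cN: "c None \<noteq> 0"
  proof
    assume 0: "c None = 0"
    then have "form i (\<lambda>j. c (Some j)) = 0" if "i \<in> T" for i using c(2)[OF that] sum_eq by simp
    then have "c (Some j) = 0" if "j \<in> J" for j using kernel_hall_pair[OF T] that by blast
    then show False using c(1) 0 by auto
  qed
  define x where "x j = c (Some j) / c None" for j
  have "form i x = form i (\<lambda>j. c (Some j)) / c None" for i
    by (simp add: form_def x_def sum_divide_distrib)
  then have "T \<subseteq> planes_at x" using c(2) sum_eq cN T(2) by (auto simp: planes_at_def)
  then have "T = planes_at x"
    using card_planes_at[of x] T(1) by (intro card_seteq) (auto simp: hall_pair_def)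
  then show ?thesis by blast
qed

lemma vertex_unique:
  assumes "hall_pair E J (planes_at x)" "planes_at y = planes_at x" "j \<in> J"
  shows "x j = y j"
proof -
  have "x j + (-1) * y j = 0"
  proof (rule kernel_hall_pair[OF assms(1) planes_at_subset _ assms(3)])
    fix i assume i: "i \<in> planes_at x"
    then have "i \<in> planes_at y" using assms by simp
    then show "form i (\<lambda>j. x j + (-1) * y j) = 0"
      using i by (simp only: form_line) (simp add: planes_at_def)
  qed
  then show ?thesis by simp
qed

text \<open>A set \<open>K\<close> violating Hall's condition has fewer equations than unknowns,
  hence carries a nonzero vector annihilated by every form at \<open>x\<close>; forms of
  non-neighbours have no coefficient on \<open>K\<close>. Equality of cardinalities combines the
  case \<open>K = J\<close> with general position.\<close>

lemma hall_pair_planes_at: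
  assumes ker: "\<And>u j. (\<And>i. i \<in> planes_at x \<Longrightarrow> form i u = 0) \<Longrightarrow> j \<in> J \<Longrightarrow> u j = 0"
  shows "hall_pair E J (planes_at x)"
  unfolding hall_pair_def
proof (intro conjI allI impI)
  have hall: "card K \<le> card (neighbours E (planes_at x) K)" if K: "K \<subseteq> J" for K
  proof (rule ccontr)
    assume "\<not> card K \<le> card (neighbours E (planes_at x) K)"
    then have "card (neighbours E (planes_at x) K) < card K" by simp
    from homogeneous_system_nontrivial_solution[OF _ _ this, of A] obtain u where u: "\<exists>j\<in>K. u j \<noteq> 0"
      "\<forall>j. j \<notin> K \<longrightarrow> u j = 0" "\<forall>i\<in>neighbours E (planes_at x) K. (\<Sum>j\<in>K. A j i * u j) = 0"
      using finite_subset[OF K finJ] by auto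
    have "form i u = 0" if i: "i \<in> planes_at x" for i
    proof -
      have "form i u = (\<Sum>j\<in>K. A j i * u j)"
        unfolding form_def by (rule sum.mono_neutral_right) (use K finJ u in auto)
      also have "\<dots> = 0"
      proof (cases "i \<in> neighbours E (planes_at x) K")
        case False
        then show ?thesis using i by (intro sum.neutral) (auto simp: neighbours_def A_zero)
      qed (use u in auto)
      finally show ?thesis .
    qed
    then show False using ker[of u] u(1) K by blast
  qed
  then show "card K \<le> card (neighbours E (planes_at x) K)" if "K \<subseteq> J" for K using that .
  have "card J \<le> card (neighbours E (planes_at x) J)" by (rule hall) simp
  also have "\<dots> \<le> card (planes_at x)" by (intro card_mono) (auto simp: neighbours_def)
  finally show "card J = card (planes_at x)" using card_planes_at[of x] by simp
qed

section \<open>Polynomial interpolation on the vertices\<close>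

text \<open>Multiply out, choosing from every factor its constant or one variable. Variables of
  \<open>K\<close> come only from factors that are neighbours of \<open>K\<close> in
  \<open>R - T\<close>, and \<open>card K\<close> is at most the number of its neighbours in
  \<open>T\<close>; so the exponents plus one satisfy Hall's condition in \<open>R\<close>.\<close>

lemma prod_forms_expand:
  assumes T: "hall_pair E J T" "T \<subseteq> R"
  shows "\<exists>c. \<forall>x. (\<Prod>i\<in>R - T. form i x - b i) = (\<Sum>w\<in>positive_hall_vectors E J R. c w * shifted_monomial w x)"
proof -
  define Q where "Q = insert None (Some ` J)"
  define F where "F = (R - T) \<rightarrow>\<^sub>E Q"
  define coef where "coef i q = (case q of None \<Rightarrow> - b i | Some j \<Rightarrow> A j i)" for i q
  define var :: "('l \<Rightarrow> real) \<Rightarrow> 'l option \<Rightarrow> real" where "var x q = (case q of None \<Rightarrow> 1 | Some j \<Rightarrow> x j)" for x q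
  define ex where "ex \<phi> = restrict (\<lambda>j. 1 + card {i \<in> R - T. \<phi> i = Some j}) J" for \<phi> :: "'r \<Rightarrow> 'l option"
  define cf where "cf \<phi> = (\<Prod>i\<in>R - T. coef i (\<phi> i))" for \<phi>
  have finF: "finite F" using finR finJ by (auto simp: F_def Q_def intro!: finite_PiE)
  have finT: "finite T" using T finR finite_subset by blast
  have vars: "(\<Prod>i\<in>R - T. var x (\<phi> i)) = shifted_monomial (ex \<phi>) x" if \<phi>: "\<phi> \<in> F" for \<phi> x
  proof -
    have "var x (\<phi> i) = (\<Prod>j\<in>J. if \<phi> i = Some j then x j else 1)" if i: "i \<in> R - T" for i
    proof (cases "\<phi> i")
      case (Some j)
      then have "j \<in> J" using \<phi> i by (auto simp: F_def Q_def dest!: PiE_mem)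
      then show ?thesis using Some finJ by (simp add: var_def)
    qed (simp add: var_def)
    then have "(\<Prod>i\<in>R - T. var x (\<phi> i)) = (\<Prod>i\<in>R - T. \<Prod>j\<in>J. if \<phi> i = Some j then x j else 1)"
      by (rule prod.cong[OF refl])
    also have "\<dots> = (\<Prod>j\<in>J. \<Prod>i\<in>R - T. if \<phi> i = Some j then x j else 1)" by (rule prod.swap)
    also have "\<dots> = (\<Prod>j\<in>J. x j ^ card {i \<in> R - T. \<phi> i = Some j})"
      using finR by (intro prod.cong refl) (simp flip: prod.inter_filter)
    also have "\<dots> = shifted_monomial (ex \<phi>) x" by (simp add: shifted_monomial_def ex_def)
    finally show ?thesis .
  qed
  have ex_mem: "ex \<phi> \<in> positive_hall_vectors E J R" if "cf \<phi> \<noteq> 0" for \<phi>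
  proof -
    have edge: "E j i" if "i \<in> R - T" "\<phi> i = Some j" for i j
      using \<open>cf \<phi> \<noteq> 0\<close> that finR A_zero[of j i] by (force simp: cf_def coef_def)
    have "sum (ex \<phi>) K \<le> card (neighbours E R K)" if K: "K \<subseteq> J" for K
    proof -
      have fK: "finite K" using K finJ finite_subset by blast
      have "sum (ex \<phi>) K = (\<Sum>j\<in>K. 1 + card {i \<in> R - T. \<phi> i = Some j})"
        by (rule sum.cong) (use K in \<open>auto simp: ex_def\<close>)
      also have "\<dots> = card K + (\<Sum>j\<in>K. card {i \<in> R - T. \<phi> i = Some j})" unfolding sum.distrib by simp
      also have "(\<Sum>j\<in>K. card {i \<in> R - T. \<phi> i = Some j}) = card (\<Union>j\<in>K. {i \<in> R - T. \<phi> i = Some j})"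
        using fK finR by (intro card_UN_disjoint[symmetric]) auto
      also have "\<dots> \<le> card (neighbours E (R - T) K)"
        using finR edge by (intro card_mono) (auto simp: neighbours_def)
      also have "card K \<le> card (neighbours E T K)" using T K by (simp add: hall_pair_def)
      also have "card (neighbours E T K) + card (neighbours E (R - T) K)
          = card (neighbours E T K \<union> neighbours E (R - T) K)"
        using finR finT by (intro card_Un_disjoint[symmetric]) (auto simp: neighbours_def)
      also have "neighbours E T K \<union> neighbours E (R - T) K = neighbours E R K"
        using T(2) by (auto simp: neighbours_def)
      finally show ?thesis by simp
    qed
    then show ?thesis by (auto simp: positive_hall_vectors_def hall_vectors_def ex_def)
  qed
  define c where "c w = (\<Sum>\<phi>\<in>{\<phi> \<in> F. ex \<phi> = w}. cf \<phi>)" for w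
  have "(\<Prod>i\<in>R - T. form i x - b i) = (\<Sum>w\<in>positive_hall_vectors E J R. c w * shifted_monomial w x)" for x
  proof -
    have "form i x - b i = (\<Sum>q\<in>Q. coef i q * var x q)" for i
      using finJ by (simp add: Q_def form_def sum.reindex coef_def var_def)
    then have "(\<Prod>i\<in>R - T. form i x - b i) = (\<Prod>i\<in>R - T. \<Sum>q\<in>Q. coef i q * var x q)" by simp
    also have "\<dots> = (\<Sum>\<phi>\<in>F. \<Prod>i\<in>R - T. coef i (\<phi> i) * var x (\<phi> i))"
      unfolding F_def using finR finJ by (intro prod_sum_PiE) (auto simp: Q_def)
    also have "\<dots> = (\<Sum>\<phi>\<in>F. cf \<phi> * shifted_monomial (ex \<phi>) x)"
      by (rule sum.cong) (simp_all add: prod.distrib vars cf_def)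
    \<comment> \<open>Choices that use a non-edge may violate Hall's condition, but their
      coefficient is zero.\<close>
    also have "\<dots> = (\<Sum>\<phi>\<in>{\<phi> \<in> F. ex \<phi> \<in> positive_hall_vectors E J R}. cf \<phi> * shifted_monomial (ex \<phi>) x)"
      by (rule sum.mono_neutral_right) (use finF ex_mem in auto)
    also have "\<dots> = (\<Sum>w\<in>positive_hall_vectors E J R.
        \<Sum>\<phi>\<in>{\<phi> \<in> {\<phi> \<in> F. ex \<phi> \<in> positive_hall_vectors E J R}. ex \<phi> = w}. cf \<phi> * shifted_monomial (ex \<phi>) x)"
      by (rule sum.group[symmetric]) (use finF finite_positive_hall_vectors[OF finJ finR] in auto)
    also have "\<dots> = (\<Sum>w\<in>positive_hall_vectors E J R. c w * shifted_monomial w x)"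
    proof (rule sum.cong[OF refl])
      fix w assume w: "w \<in> positive_hall_vectors E J R"
      have "{\<phi> \<in> {\<phi> \<in> F. ex \<phi> \<in> positive_hall_vectors E J R}. ex \<phi> = w} = {\<phi> \<in> F. ex \<phi> = w}"
        using w by auto
      then show "(\<Sum>\<phi>\<in>{\<phi> \<in> {\<phi> \<in> F. ex \<phi> \<in> positive_hall_vectors E J R}. ex \<phi> = w}. cf \<phi> * shifted_monomial (ex \<phi>) x)
          = c w * shifted_monomial w x"
        by (simp add: c_def sum_distrib_right)
    qed
    finally show ?thesis .
  qed
  then show ?thesis by blast
qed

text \<open>With more vertices than monomials, a nontrivial combination of point evaluations would
  annihilate every monomial, hence also the product attached to a vertex \<open>T\<close> occurring
  in it. That product vanishes at all other vertices, so it would vanish at \<open>T\<close> too,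
  forcing an extra hyperplane through that vertex.\<close>

lemma card_hall_pairs_le:
  "card {T. T \<subseteq> R \<and> hall_pair E J T} \<le> card (positive_hall_vectors E J R)"
proof (rule ccontr)
  let ?B = "{T. T \<subseteq> R \<and> hall_pair E J T}" and ?P = "positive_hall_vectors E J R"
  assume "\<not> ?thesis"
  then have less: "card ?P < card ?B" by simp
  have "\<forall>T\<in>?B. \<exists>x. planes_at x = T" using vertex_exists by blast
  then obtain vx where vx: "\<And>T. T \<in> ?B \<Longrightarrow> planes_at (vx T) = T" by metis
  have finB: "finite ?B" by (rule finite_subset[of _ "Pow R"]) (use finR in auto)
  from homogeneous_system_nontrivial_solution[OF finite_positive_hall_vectors[OF finJ finR] finB less,
      of "\<lambda>T w. shifted_monomial w (vx T)"]
  obtain d where d: "\<exists>T\<in>?B. d T \<noteq> 0" "\<forall>w\<in>?P. (\<Sum>T\<in>?B. shifted_monomial w (vx T) * d T) = 0"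
    by auto
  then obtain T where T: "T \<in> ?B" "d T \<noteq> 0" by blast
  obtain c where c: "\<And>x. (\<Prod>i\<in>R - T. form i x - b i) = (\<Sum>w\<in>?P. c w * shifted_monomial w x)"
    using prod_forms_expand[of T] T by blast
  define p where "p x = (\<Prod>i\<in>R - T. form i x - b i)" for x
  have "p (vx T') = 0" if T': "T' \<in> ?B" "T' \<noteq> T" for T'
  proof -
    have "card T' = card T" "finite T" using T' T finR finite_subset[of T R] by (auto simp: hall_pair_def)
    then have "\<not> T' \<subseteq> T" using T' card_subset_eq by blast
    then obtain i where i: "i \<in> T'" "i \<notin> T" by blast
    then have "form i (vx T') - b i = 0" using vx[OF T'(1)] by (auto simp: planes_at_def)
    then show ?thesis unfolding p_def using i T' finR by (intro prod_zero) auto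
  qed
  then have "(\<Sum>T'\<in>?B. p (vx T') * d T') = p (vx T) * d T"
    using T finB by (subst sum.remove[of _ T]) (auto intro!: sum.neutral)
  moreover have "(\<Sum>T'\<in>?B. p (vx T') * d T') = (\<Sum>T'\<in>?B. \<Sum>w\<in>?P. c w * (shifted_monomial w (vx T') * d T'))"
    by (simp add: p_def c sum_distrib_right mult.assoc)
  moreover have "\<dots> = (\<Sum>w\<in>?P. c w * (\<Sum>T'\<in>?B. shifted_monomial w (vx T') * d T'))"
    by (subst sum.swap) (simp add: sum_distrib_left)
  moreover have "\<dots> = 0" using d(2) by simp
  ultimately have "p (vx T) = 0" using T(2) by simp
  then obtain i where "i \<in> R - T" "form i (vx T) - b i = 0"
    unfolding p_def using finR by (auto simp: prod_zero_iff)
  then have "i \<in> planes_at (vx T)" by (auto simp: planes_at_def)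
  then show False using vx[OF T(1)] \<open>i \<in> R - T\<close> by simp
qed

lemma ex_form_nonzero:
  assumes hall: "card {j \<in> J. u j \<noteq> 0} \<le> card (neighbours E R {j \<in> J. u j \<noteq> 0})"
    and j: "j \<in> J" "u j \<noteq> 0"
  shows "\<exists>i\<in>R. form i u \<noteq> 0"
proof (rule ccontr)
  assume "\<not> ?thesis"
  then have "{i \<in> neighbours E R {j \<in> J. u j \<noteq> 0}. form i u = 0} = neighbours E R {j \<in> J. u j \<noteq> 0}"
    by (auto simp: neighbours_def)
  then show False using card_form_zero[of j u] j hall by simp
qed

text \<open>The scalar is the parameter at which the line through \<open>x\<close> in direction
  \<open>u\<close> crosses hyperplane \<open>i\<close>; the hyperplanes already through
  \<open>x\<close> contain the whole line.\<close>

lemma planes_at_line: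
  assumes "\<And>s. s \<in> planes_at x \<Longrightarrow> form s u = 0" "i \<in> R" "form i u \<noteq> 0"
  shows "insert i (planes_at x) \<subseteq> planes_at (\<lambda>j. x j + (b i - form i x) / form i u * u j)"
  unfolding planes_at_def form_line using assms by (auto simp: planes_at_def)

text \<open>The normals of the hyperplanes through any point are linearly independent: moving along a
  direction in their common kernel only enlarges this set of hyperplanes, until it is a basis.\<close>

lemma planes_at_independent:
  assumes hall: "\<And>K. K \<subseteq> J \<Longrightarrow> card K \<le> card (neighbours E R K)"
    and i: "i \<in> planes_at x"
  shows "\<exists>u. form i u \<noteq> 0 \<and> (\<forall>s\<in>planes_at x - {i}. form s u = 0)"
  using i
proof (induction "card J - card (planes_at x)" arbitrary: x rule: less_induct)
  case less
  show ?case
  proof (cases "\<exists>u. (\<forall>i\<in>planes_at x. form i u = 0) \<and> (\<exists>j\<in>J. u j \<noteq> 0)")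
    case True
    then obtain u j where u: "\<And>i. i \<in> planes_at x \<Longrightarrow> form i u = 0" and j: "j \<in> J" "u j \<noteq> 0" by blast
    have "card {j \<in> J. u j \<noteq> 0} \<le> card (neighbours E R {j \<in> J. u j \<noteq> 0})" by (rule hall) auto
    from ex_form_nonzero[OF this j] obtain k where k: "k \<in> R" "form k u \<noteq> 0" by blast
    define y where "y = (\<lambda>j. x j + (b k - form k x) / form k u * u j)"
    have sub: "insert k (planes_at x) \<subseteq> planes_at y"
      unfolding y_def using planes_at_line[of x u k] u k by blast
    have "k \<notin> planes_at x" using u k by blast
    then have "card (planes_at x) < card (planes_at y)"
      using sub by (intro psubset_card_mono) auto
    then have "card J - card (planes_at y) < card J - card (planes_at x)"
      using card_planes_at[of y] by linarith
    from less.hyps[OF this] show ?thesis using sub less.prems by blast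
  next
    case False
    then have ker: "u j = 0" if "\<And>i. i \<in> planes_at x \<Longrightarrow> form i u = 0" "j \<in> J" for u j
      using that by blast
    have "hall_pair E J (planes_at x)" by (rule hall_pair_planes_at) (use ker in blast)
    then have "card (planes_at x - {i}) < card J"
      using card_Diff1_less[OF finite_planes_at less.prems] unfolding hall_pair_def by linarith
    from homogeneous_system_nontrivial_solution[OF _ finJ this, of A] obtain u
      where u: "\<exists>j\<in>J. u j \<noteq> 0" "\<forall>s\<in>planes_at x - {i}. form s u = 0"
      by (auto simp: form_def)
    have "form i u \<noteq> 0" using ker[of u] u by blast
    then show ?thesis using u by blast
  qed
qed

text \<open>Downward induction on the set of hyperplanes through the point: a generic line in their
  intersection meets the other hyperplanes in more distinct points than the degree of the
  polynomial along the line.\<close>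

lemma vanishing_of_vanishing_at_vertices:
  fixes c :: "('l \<Rightarrow> nat) \<Rightarrow> real"
  defines "f \<equiv> \<lambda>x. \<Sum>w\<in>positive_hall_vectors E J R. c w * shifted_monomial w x"
  assumes vert: "\<And>x. hall_pair E J (planes_at x) \<Longrightarrow> f x = 0"
  shows "f x = 0"
proof (cases "positive_hall_vectors E J R = {}")
  case True
  then show ?thesis by (simp add: f_def)
next
  case False
  then obtain w0 where w0: "w0 \<in> positive_hall_vectors E J R" by blast
  \<comment> \<open>A positive Hall vector dominates the all-ones vector, so its existence gives
    Hall's condition for \<open>J\<close> itself.\<close>
  have hall: "card K \<le> card (neighbours E R K)" if K: "K \<subseteq> J" for K
  proof -
    have "card K \<le> sum w0 K"
      using w0 K sum_mono[of K "\<lambda>_. 1" w0] by (force simp: positive_hall_vectors_def)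
    also have "\<dots> \<le> card (neighbours E R K)"
      using w0 K by (simp add: positive_hall_vectors_def hall_vectors_def)
    finally show ?thesis .
  qed
  show ?thesis
  proof (induction "card J - card (planes_at x)" arbitrary: x rule: less_induct)
    case less
    define V where "V = {u. \<forall>i\<in>planes_at x. form i u = 0}"
    show ?case
    proof (cases "\<exists>u\<in>V. \<exists>j\<in>J. u j \<noteq> 0")
      case False
      then have "hall_pair E J (planes_at x)"
        by (intro hall_pair_planes_at) (auto simp: V_def)
      then show ?thesis by (rule vert)
    next
      case True
      then obtain u0 j0 where u0: "u0 \<in> V" "j0 \<in> J" "u0 j0 \<noteq> 0" by blast
      define r where "r i = b i - form i x" for i
      define I where "I = {i \<in> R. \<exists>v\<in>V. form i v \<noteq> 0}"
      \<comment> \<open>When both forms are nonzero on \<open>u\<close>, \<open>h i i' u = 0\<close>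
        says that the line through \<open>x\<close> in direction \<open>u\<close> meets hyperplanes
        \<open>i\<close> and \<open>i'\<close> at the same parameter.\<close>
      define h where "h i i' u = r i * form i' u - r i' * form i u" for i i' u
      have Isub: "I \<subseteq> R - planes_at x" by (auto simp: I_def V_def)
      have h_nonzero: "\<exists>v\<in>V. h i i' v \<noteq> 0" if ii': "i \<in> I" "i' \<in> I" "i \<noteq> i'" for i i'
      proof (rule ccontr)
        assume "\<not> ?thesis"
        then have h0: "\<And>v. v \<in> V \<Longrightarrow> r i * form i' v = r i' * form i v" by (auto simp: h_def)
        obtain v where v: "v \<in> V" "form i v \<noteq> 0" using ii' by (auto simp: I_def)
        \<comment> \<open>If the crossings always coincided, both hyperplanes would pass through
          \<open>y\<close>. Independence at \<open>y\<close> then supplies a direction in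
          \<open>V\<close> on which \<open>form i\<close> vanishes but \<open>form i'\<close> does
          not.\<close>
        define y where "y = (\<lambda>j. x j + r i / form i v * v j)"
        have sub: "insert i (planes_at x) \<subseteq> planes_at y"
          unfolding y_def r_def using planes_at_line[of x v i] v ii' by (auto simp: V_def I_def)
        have "form i' y = b i'"
          unfolding y_def form_line using h0[OF v(1)] v(2) by (simp add: field_simps r_def)
        then have i'y: "i' \<in> planes_at y" using ii' by (auto simp: planes_at_def I_def)
        then obtain u where u: "form i' u \<noteq> 0" "\<And>s. s \<in> planes_at y - {i'} \<Longrightarrow> form s u = 0"
          using planes_at_independent[OF hall i'y] by blast
        have "u \<in> V" using sub u(2) ii' Isub by (auto simp: V_def)
        moreover have "form i u = 0" using sub u(2) ii' by auto
        moreover have "r i \<noteq> 0" using ii' Isub by (auto simp: r_def planes_at_def)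
        ultimately show False using h0[of u] u(1) by simp
      qed
      define G where "G = form ` I \<union> (\<lambda>(i, i'). h i i') ` {(i, i') \<in> I \<times> I. i \<noteq> i'}"
      have finI: "finite I" using finR by (simp add: I_def)
      have "\<exists>v\<in>V. \<forall>g\<in>G. g v \<noteq> 0"
      proof (rule avoid_finitely_many_hyperplanes)
        have "finite {(i, i') \<in> I \<times> I. i \<noteq> i'}"
          by (rule finite_subset[of _ "I \<times> I"]) (use finI in auto)
        then show "finite G" using finI by (simp add: G_def)
        show "(\<lambda>a. u a + t * v a) \<in> V" if "u \<in> V" "v \<in> V" for u v t
          using that by (auto simp: V_def form_line)
        show "g (\<lambda>a. u a + t * v a) = g u + t * g v" if "g \<in> G" for g u v t
          using that by (auto simp: G_def h_def form_line algebra_simps)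
        show "\<exists>v\<in>V. g v \<noteq> 0" if "g \<in> G" for g
          using that h_nonzero by (auto simp: G_def I_def)
      qed (use u0 in blast)
      then obtain u where u: "u \<in> V" "\<And>i. i \<in> I \<Longrightarrow> form i u \<noteq> 0"
        "\<And>i i'. i \<in> I \<Longrightarrow> i' \<in> I \<Longrightarrow> i \<noteq> i' \<Longrightarrow> h i i' u \<noteq> 0"
        unfolding G_def by fast
      define K where "K = {j \<in> J. u j \<noteq> 0}"
      have "card {j \<in> J. u0 j \<noteq> 0} \<le> card (neighbours E R {j \<in> J. u0 j \<noteq> 0})" by (rule hall) auto
      from ex_form_nonzero[OF this u0(2,3)] have "I \<noteq> {}" using u0(1) by (auto simp: I_def)
      then obtain i0 where "form i0 u \<noteq> 0" using u(2) by blast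
      then obtain j1 where j1: "j1 \<in> J" "u j1 \<noteq> 0"
        unfolding form_def by (metis (no_types, lifting) mult_zero_right sum.neutral)
      have I_eq: "I = {i \<in> R. form i u \<noteq> 0}" using u by (auto simp: I_def)
      define t where "t i = r i / form i u" for i
      have inj: "inj_on t I"
      proof (rule inj_onI, rule ccontr)
        fix i i' assume i: "i \<in> I" "i' \<in> I" "t i = t i'" "i \<noteq> i'"
        then have "h i i' u = 0" using u(2) by (simp add: t_def h_def field_simps)
        then show False using u(3) i by blast
      qed
      define p where "p = (\<Sum>w\<in>positive_hall_vectors E J R. smult (c w) (\<Prod>j\<in>J. [:x j, u j:] ^ (w j - 1)))"
      have poly_p: "poly p s = f (\<lambda>j. x j + s * u j)" for s
        by (simp add: p_def f_def shifted_monomial_def poly_sum poly_prod)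
      have roots: "poly p (t i) = 0" if i: "i \<in> I" for i
      proof -
        define y where "y = (\<lambda>j. x j + t i * u j)"
        have sub: "insert i (planes_at x) \<subseteq> planes_at y"
          unfolding y_def r_def t_def using planes_at_line[of x u i] u i by (auto simp: V_def I_def)
        have "i \<notin> planes_at x" using i Isub by blast
        then have "card (planes_at x) < card (planes_at y)"
          using sub by (intro psubset_card_mono) auto
        then have "card J - card (planes_at y) < card J - card (planes_at x)"
          using card_planes_at[of y] by linarith
        from less[OF this] show ?thesis by (simp add: poly_p y_def)
      qed
      \<comment> \<open>Coordinates outside \<open>K\<close> are constant on the line, so the degree
        is at most the sum of \<open>w j - 1\<close> over \<open>K\<close>, hence at most the number
        of neighbours of \<open>K\<close> minus \<open>card K\<close>. Fewer than
        \<open>card K\<close> of these neighbours have a form vanishing on \<open>u\<close>; the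
        others lie in \<open>I\<close>.\<close>
      have deg: "degree (\<Prod>j\<in>J. [:x j, u j:] ^ (w j - 1)) < card I"
        if w: "w \<in> positive_hall_vectors E J R" for w
      proof -
        have fK: "finite K" using finJ by (simp add: K_def)
        have pos: "w j \<ge> 1" if "j \<in> K" for j using w that by (force simp: positive_hall_vectors_def K_def)
        have "degree (\<Prod>j\<in>J. [:x j, u j:] ^ (w j - 1)) \<le> (\<Sum>j\<in>J. degree ([:x j, u j:] ^ (w j - 1)))"
          using degree_prod_sum_le[OF finJ] by (simp add: o_def)
        also have "\<dots> \<le> (\<Sum>j\<in>J. if u j \<noteq> 0 then w j - 1 else 0)"
          by (rule sum_mono) (auto intro: order_trans[OF degree_power_le] simp: poly_const_pow)
        also have "\<dots> = (\<Sum>j\<in>K. w j - 1)" unfolding K_def by (rule sum.inter_filter[OF finJ, symmetric])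
        finally have d: "degree (\<Prod>j\<in>J. [:x j, u j:] ^ (w j - 1)) \<le> (\<Sum>j\<in>K. w j - 1)" .
        have "(\<Sum>j\<in>K. w j - 1) + card K = (\<Sum>j\<in>K. (w j - 1) + 1)" by (simp only: sum.distrib) simp
        also have "\<dots> = sum w K" by (rule sum.cong) (use pos in force)+
        also have "\<dots> \<le> card (neighbours E R K)"
          using w by (auto simp: positive_hall_vectors_def hall_vectors_def K_def)
        also have "\<dots> = card ({i \<in> neighbours E R K. form i u = 0} \<union> I)"
          using form_nonneighbour[of _ u] by (intro arg_cong[of _ _ card]) (auto simp: I_eq K_def neighbours_def)
        also have "\<dots> \<le> card {i \<in> neighbours E R K. form i u = 0} + card I" by (rule card_Un_le)
        finally show ?thesis using d card_form_zero[of j1 u] j1 by (simp add: K_def)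
      qed
      have "card I > 0" using finI \<open>I \<noteq> {}\<close> by (simp add: card_gt_0_iff)
      then have deg_p: "degree p < card I"
        unfolding p_def by (intro degree_sum_less le_less_trans[OF degree_smult_le] deg)
      have "p = 0"
      proof (rule ccontr)
        assume p: "p \<noteq> 0"
        have "card I = card (t ` I)" using inj by (simp add: card_image)
        also have "\<dots> \<le> card {s. poly p s = 0}"
          using roots p by (intro card_mono) (auto simp: poly_roots_finite)
        also have "\<dots> \<le> degree p" by (rule card_poly_roots_bound[OF p])
        finally show False using deg_p by simp
      qed
      then show ?thesis using poly_p[of 0] by simp
    qed
  qed
qed

lemma card_positive_hall_vectors_le:
  "card (positive_hall_vectors E J R) \<le> card {T. T \<subseteq> R \<and> hall_pair E J T}"
proof (rule ccontr)
  let ?B = "{T. T \<subseteq> R \<and> hall_pair E J T}" and ?P = "positive_hall_vectors E J R"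
  assume "\<not> ?thesis"
  then have less: "card ?B < card ?P" by simp
  have "\<forall>T\<in>?B. \<exists>x. planes_at x = T" using vertex_exists by blast
  then obtain vx where vx: "\<And>T. T \<in> ?B \<Longrightarrow> planes_at (vx T) = T" by metis
  have finB: "finite ?B" by (rule finite_subset[of _ "Pow R"]) (use finR in auto)
  note finP = finite_positive_hall_vectors[OF finJ finR]
  from homogeneous_system_nontrivial_solution[OF finB finP less, of "\<lambda>w T. shifted_monomial w (vx T)"]
  obtain c where c: "\<exists>w\<in>?P. c w \<noteq> 0" "\<forall>T\<in>?B. (\<Sum>w\<in>?P. shifted_monomial w (vx T) * c w) = 0"
    by auto
  have "(\<Sum>w\<in>?P. c w * shifted_monomial w x) = 0" for x
  proof (rule vanishing_of_vanishing_at_vertices)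
    fix x assume hp: "hall_pair E J (planes_at x)"
    then have B: "planes_at x \<in> ?B" by (simp add: planes_at_subset)
    \<comment> \<open>Vertices are unique only in the coordinates of \<open>J\<close>, which are all
      that the monomials read.\<close>
    have "shifted_monomial w x = shifted_monomial w (vx (planes_at x))" for w
      unfolding shifted_monomial_def by (rule prod.cong) (use vertex_unique[OF hp vx[OF B]] in auto)
    then show "(\<Sum>w\<in>?P. c w * shifted_monomial w x) = 0" using c(2) B by (simp add: mult.commute)
  qed
  \<comment> \<open>Multiplying by all variables undoes the shift, so that distinct \<open>w\<close>
    give distinct monomials with exponents \<open>w\<close>.\<close>
  then have f0: "(\<Sum>w\<in>?P. c w * shifted_monomial w x) * (\<Prod>j\<in>J. x j) = 0" for x by simp
  have "(\<Sum>w\<in>?P. c w * (\<Prod>j\<in>J. x j ^ w j)) = 0" for x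
  proof -
    have "shifted_monomial w x * (\<Prod>j\<in>J. x j) = (\<Prod>j\<in>J. x j ^ w j)" if "w \<in> ?P" for w
      unfolding shifted_monomial_def prod.distrib[symmetric]
      by (rule prod.cong) (use that in \<open>auto simp: positive_hall_vectors_def power_eq_if\<close>)
    then show ?thesis using f0[of x] by (simp add: sum_distrib_right mult.assoc)
  qed
  from monomials_linearly_independent[OF finJ finP _ this] have "c w = 0" if "w \<in> ?P" for w
    using that by (auto simp: positive_hall_vectors_def hall_vectors_def PiE_def)
  then show False using c(1) by blast
qed

end

text \<open>The affine terms of the arrangement come from an extra left vertex adjacent to everything.\<close>

theorem card_positive_hall_vectors:
  fixes E :: "'l \<Rightarrow> 'r \<Rightarrow> bool"
  assumes "finite J" "finite R"
  shows "card (positive_hall_vectors E J R) = card {T. T \<subseteq> R \<and> hall_pair E J T}"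
proof -
  define E' where "E' q i = (case q of None \<Rightarrow> True | Some j \<Rightarrow> E j i)" for q :: "'l option" and i
  let ?J = "insert None (Some ` J)"
  obtain B where B: "generic_matrix E' ?J R B"
    using generic_matrix_exists[of R ?J] assms by blast
  define A where "A j i = B (Some j) i" for j i
  define b where "b i = - B None i" for i
  have nb: "neighbours E' R (Some ` K) = neighbours E R K" for K
    by (auto simp: neighbours_def E'_def)
  interpret generic_arrangement E J R A b
  proof
    show "finite J" "finite R" by fact+
    show "generic_matrix E J R A"
      unfolding generic_matrix_def
    proof (intro conjI allI impI)
      show "A j i = 0" if "\<not> E j i" for j i
        using B that by (simp add: generic_matrix_def A_def E'_def)
      fix u :: "'l \<Rightarrow> real" and K
      assume K: "K = {j \<in> J. u j \<noteq> 0} \<and> K \<noteq> {}"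
      let ?u = "\<lambda>q. case q of None \<Rightarrow> 0 | Some j \<Rightarrow> u j"
      have "Some ` K = {q \<in> ?J. ?u q \<noteq> 0}" using K by auto
      from generic_matrixD[OF B this]
      have "card {i \<in> neighbours E' R (Some ` K). (\<Sum>q\<in>?J. B q i * ?u q) = 0} < card (Some ` K)"
        using K by blast
      then show "card {i \<in> neighbours E R K. (\<Sum>j\<in>J. A j i * u j) = 0} < card K"
        using assms(1) by (simp add: nb card_image sum.reindex A_def)
    qed
    fix x :: "'l \<Rightarrow> real"
    \<comment> \<open>Homogeneous coordinates: the value 1 at \<open>None\<close> makes every right
      vertex a neighbour of the support, which has at most \<open>card J + 1\<close> elements; the
      strict bound then leaves \<open>card J\<close>.\<close>
    let ?x = "\<lambda>q. case q of None \<Rightarrow> 1 | Some j \<Rightarrow> x j"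
    let ?K = "{q \<in> ?J. ?x q \<noteq> 0}"
    have N: "None \<in> ?K" by simp
    have "card {i \<in> neighbours E' R ?K. (\<Sum>q\<in>?J. B q i * ?x q) = 0} < card ?K"
      by (rule generic_matrixD[OF B refl]) (use N in blast)
    moreover have "neighbours E' R ?K = R" using N by (auto simp: neighbours_def E'_def)
    moreover have "(\<Sum>q\<in>?J. B q i * ?x q) = 0 \<longleftrightarrow> (\<Sum>j\<in>J. A j i * x j) = b i" for i
      using assms(1) by (simp add: sum.reindex A_def b_def) linarith
    ultimately have "card {i \<in> R. (\<Sum>j\<in>J. A j i * x j) = b i} < card ?K" by simp
    also have "\<dots> \<le> card ?J" using assms(1) by (intro card_mono) auto
    also have "\<dots> = Suc (card J)" using assms(1) by (simp add: card_image)
    finally show "card {i \<in> R. (\<Sum>j\<in>J. A j i * x j) = b i} \<le> card J" by simp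
  qed
  show ?thesis using card_positive_hall_vectors_le card_hall_pairs_le by (rule antisym)
qed

section \<open>Duality between left and right Hall vectors\<close>

text \<open>Apply Hall's condition to the vertices of \<open>J\<close> without a neighbour in
  \<open>S\<close>: all their neighbours in \<open>T\<close> lie in \<open>T - S\<close>.
  Complementing, with \<open>card J = card T\<close>, gives the condition for
  \<open>S\<close>.\<close>

lemma hall_pair_transpose:
  assumes "finite J" "finite T" and pair: "hall_pair E J T"
  shows "hall_pair (\<lambda>i j. E j i) T J"
  unfolding hall_pair_def
proof (intro conjI allI impI)
  show "card T = card J" using pair by (simp add: hall_pair_def)
  fix S assume S: "S \<subseteq> T"
  let ?N = "neighbours (\<lambda>i j. E j i) J S"
  have "card (J - ?N) \<le> card (neighbours E T (J - ?N))" using pair by (simp add: hall_pair_def)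
  also have "\<dots> \<le> card (T - S)" using assms by (intro card_mono) (auto simp: neighbours_def)
  finally have "card J - card ?N \<le> card T - card S"
    using assms S finite_subset[OF S] by (simp add: card_Diff_subset neighbours_def)
  moreover have "card S \<le> card T" using assms S by (intro card_mono)
  ultimately show "card S \<le> card ?N" using pair by (simp add: hall_pair_def)
qed

lemma hall_pair_transpose_iff:
  assumes "finite J" "finite T"
  shows "hall_pair (\<lambda>i j. E j i) T J \<longleftrightarrow> hall_pair E J T"
  using hall_pair_transpose[of J T E] hall_pair_transpose[of T J "\<lambda>i j. E j i"] assms by auto

lemma card_hall_vectors_with_support:
  assumes "finite L" "finite R" "J \<subseteq> L"
  shows "card {w \<in> hall_vectors E L R. {j \<in> L. w j \<noteq> 0} = J} = card (positive_hall_vectors E J R)"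
proof (rule bij_betw_same_card[of "\<lambda>w. restrict w J"], rule bij_betwI[of _ _ _ "\<lambda>w. \<lambda>j\<in>L. if j \<in> J then w j else 0"])
  have finJ: "finite J" using assms finite_subset by blast
  show "(\<lambda>w. restrict w J) \<in> {w \<in> hall_vectors E L R. {j \<in> L. w j \<noteq> 0} = J} \<rightarrow> positive_hall_vectors E J R"
  proof
    fix w assume w: "w \<in> {w \<in> hall_vectors E L R. {j \<in> L. w j \<noteq> 0} = J}"
    have "sum (restrict w J) K \<le> card (neighbours E R K)" if "K \<subseteq> J" for K
    proof -
      have "sum (restrict w J) K = sum w K" by (rule sum.cong) (use that in auto)
      also have "\<dots> \<le> card (neighbours E R K)" using w that assms by (auto simp: hall_vectors_def)
      finally show ?thesis .
    qed
    then show "restrict w J \<in> positive_hall_vectors E J R"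
      using w by (auto simp: positive_hall_vectors_def hall_vectors_def)
  qed
  show "(\<lambda>w. \<lambda>j\<in>L. if j \<in> J then w j else 0) \<in> positive_hall_vectors E J R \<rightarrow> {w \<in> hall_vectors E L R. {j \<in> L. w j \<noteq> 0} = J}"
  proof
    fix w assume w: "w \<in> positive_hall_vectors E J R"
    define v where "v = (\<lambda>j\<in>L. if j \<in> J then w j else 0)"
    have "sum v K \<le> card (neighbours E R K)" if "K \<subseteq> L" for K
    proof -
      have "sum v K = sum w (K \<inter> J)"
        using that assms finite_subset[of K L] by (intro sum.mono_neutral_cong_right) (auto simp: v_def)
      also have "\<dots> \<le> card (neighbours E R (K \<inter> J))"
        using w by (simp add: positive_hall_vectors_def hall_vectors_def)
      also have "\<dots> \<le> card (neighbours E R K)"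
        using assms by (intro card_mono) (auto simp: neighbours_def)
      finally show ?thesis .
    qed
    then show "v \<in> {w \<in> hall_vectors E L R. {j \<in> L. w j \<noteq> 0} = J}"
      using w assms by (auto simp: positive_hall_vectors_def hall_vectors_def v_def)
  qed
  show "(\<lambda>j\<in>L. if j \<in> J then restrict w J j else 0) = w"
    if "w \<in> {w \<in> hall_vectors E L R. {j \<in> L. w j \<noteq> 0} = J}" for w
  proof (rule extensionalityI)
    show "w \<in> extensional L" using that by (simp add: hall_vectors_def PiE_def)
  qed (use that in auto)
  show "restrict (\<lambda>j\<in>L. if j \<in> J then w j else 0) J = w" if "w \<in> positive_hall_vectors E J R" for w
  proof (rule extensionalityI)
    show "w \<in> extensional J" using that by (simp add: positive_hall_vectors_def hall_vectors_def PiE_def)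
  qed (use assms in auto)
qed

lemma sum_over_hall_vectors:
  fixes g :: "nat \<Rightarrow> nat"
  assumes "finite L" "finite R"
  shows "(\<Sum>w\<in>hall_vectors E L R. g (card {j \<in> L. w j \<noteq> 0}))
       = (\<Sum>J\<in>Pow L. \<Sum>T\<in>Pow R. if hall_pair E J T then g (card J) else 0)"
proof -
  have "(\<Sum>w\<in>hall_vectors E L R. g (card {j \<in> L. w j \<noteq> 0}))
      = (\<Sum>J\<in>Pow L. \<Sum>w\<in>{w \<in> hall_vectors E L R. {j \<in> L. w j \<noteq> 0} = J}. g (card {j \<in> L. w j \<noteq> 0}))"
    by (rule sum.group[symmetric]) (use assms finite_hall_vectors in auto)
  also have "\<dots> = (\<Sum>J\<in>Pow L. card {T. T \<subseteq> R \<and> hall_pair E J T} * g (card J))"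
  proof (rule sum.cong[OF refl])
    fix J assume J: "J \<in> Pow L"
    then have "finite J" using assms finite_subset by auto
    then show "(\<Sum>w\<in>{w \<in> hall_vectors E L R. {j \<in> L. w j \<noteq> 0} = J}. g (card {j \<in> L. w j \<noteq> 0}))
        = card {T. T \<subseteq> R \<and> hall_pair E J T} * g (card J)"
      using J assms card_hall_vectors_with_support[OF assms(1,2), of J E] card_positive_hall_vectors[of J R E] by simp
  qed
  also have "\<dots> = (\<Sum>J\<in>Pow L. \<Sum>T\<in>Pow R. if hall_pair E J T then g (card J) else 0)"
  proof (rule sum.cong[OF refl])
    fix J
    have "(\<Sum>T\<in>Pow R. if hall_pair E J T then g (card J) else 0) = (\<Sum>T\<in>{T \<in> Pow R. hall_pair E J T}. g (card J))"
      using assms by (intro sum.inter_filter[symmetric]) simp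
    then show "card {T. T \<subseteq> R \<and> hall_pair E J T} * g (card J) = (\<Sum>T\<in>Pow R. if hall_pair E J T then g (card J) else 0)"
      by simp
  qed
  finally show ?thesis .
qed

theorem hall_vectors_duality:
  fixes g :: "nat \<Rightarrow> nat"
  assumes "finite L" "finite R"
  shows "(\<Sum>w\<in>hall_vectors E L R. g (card {j \<in> L. w j \<noteq> 0}))
       = (\<Sum>y\<in>hall_vectors (\<lambda>i j. E j i) R L. g (card {i \<in> R. y i \<noteq> 0}))"
proof -
  have "(\<Sum>J\<in>Pow L. \<Sum>T\<in>Pow R. if hall_pair E J T then g (card J) else 0)
      = (\<Sum>T\<in>Pow R. \<Sum>J\<in>Pow L. if hall_pair E J T then g (card J) else 0)" by (rule sum.swap)
  \<comment> \<open>Hall pairs have equal cardinalities, so the weight can be read off from either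
    side.\<close>
  also have "\<dots> = (\<Sum>T\<in>Pow R. \<Sum>J\<in>Pow L. if hall_pair (\<lambda>i j. E j i) T J then g (card T) else 0)"
  proof (intro sum.cong refl)
    fix T J assume "T \<in> Pow R" "J \<in> Pow L"
    then have "finite T" "finite J" using assms by (auto intro: finite_subset)
    moreover have "card J = card T" if "hall_pair E J T" using that by (simp add: hall_pair_def)
    ultimately show "(if hall_pair E J T then g (card J) else 0) = (if hall_pair (\<lambda>i j. E j i) T J then g (card T) else 0)"
      using hall_pair_transpose_iff[of J T E] by simp
  qed
  finally show ?thesis unfolding sum_over_hall_vectors[OF assms] sum_over_hall_vectors[OF assms(2,1)] .
qed

section \<open>Draconian sequences and Hall vectors of the blown-up graph\<close>

definition compositions :: "nat \<Rightarrow> nat \<Rightarrow> (nat \<Rightarrow> nat) set" where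
  "compositions a k = {u \<in> {..<k} \<rightarrow>\<^sub>E UNIV. sum u {..<k} = a}"

lemma c_coeff_Suc_left: "c_coeff (Suc d) k = (\<Sum>r\<le>d. 2 ^ Suc r * (k choose Suc r) * (d choose r))"
proof -
  have "c_coeff (Suc d) k = (\<Sum>r = 1..min (Suc d) k. 2 ^ r * (k choose r) * (d choose (r - 1)))"
    by (simp add: c_coeff_def)
  also have "\<dots> = (\<Sum>r = 1..Suc d. 2 ^ r * (k choose r) * (d choose (r - 1)))"
    by (rule sum.mono_neutral_left) (auto simp: not_le)
  also have "\<dots> = (\<Sum>r\<le>d. 2 ^ Suc r * (k choose Suc r) * (d choose r))"
    unfolding One_nat_def by (subst sum.shift_bounds_cl_Suc_ivl) (simp add: atLeast0AtMost)
  finally show ?thesis .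
qed

text \<open>Pascal's rule splits \<open>Suc d choose Suc r\<close>: one part continues the sum for
  \<open>d\<close>, the other is the new term \<open>c_coeff (Suc d) k\<close>. The right-hand side
  is a Delannoy number.\<close>

lemma sum_c_coeff: "(\<Sum>b\<le>d. c_coeff b k) = (\<Sum>r\<le>d. 2 ^ r * (k choose r) * (d choose r))"
proof (induction d)
  case 0
  then show ?case by (simp add: c_coeff_def)
next
  case (Suc d)
  have "(\<Sum>r\<le>Suc d. 2 ^ r * (k choose r) * (Suc d choose r))
      = 1 + (\<Sum>r\<le>d. 2 ^ Suc r * (k choose Suc r) * (Suc d choose Suc r))"
    by (subst sum.atMost_Suc_shift) simp
  also have "(\<Sum>r\<le>d. 2 ^ Suc r * (k choose Suc r) * (Suc d choose Suc r))
      = (\<Sum>r\<le>d. 2 ^ Suc r * (k choose Suc r) * (d choose Suc r)) + c_coeff (Suc d) k"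
    unfolding c_coeff_Suc_left sum.distrib[symmetric] by (rule sum.cong) (simp_all add: algebra_simps)
  also have "1 + ((\<Sum>r\<le>d. 2 ^ Suc r * (k choose Suc r) * (d choose Suc r)) + c_coeff (Suc d) k)
      = (\<Sum>r\<le>Suc d. 2 ^ r * (k choose r) * (d choose r)) + c_coeff (Suc d) k"
    by (subst sum.atMost_Suc_shift[of _ d]) simp
  also have "(\<Sum>r\<le>Suc d. 2 ^ r * (k choose r) * (d choose r)) = (\<Sum>r\<le>d. 2 ^ r * (k choose r) * (d choose r))"
    by simp
  finally show ?case using Suc by simp
qed

text \<open>Combinatorially, the last part of a composition is zero with weight 1 or positive with
  weight 2. The proof is Pascal's rule in \<open>k\<close>, with partial sums evaluated by
  \<open>sum_c_coeff\<close>.\<close>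

lemma c_coeff_Suc_right: "c_coeff a (Suc k) = c_coeff a k + 2 * (\<Sum>b<a. c_coeff b k)"
proof (cases a)
  case 0
  then show ?thesis by (simp add: c_coeff_def)
next
  case (Suc d)
  have "c_coeff a (Suc k) = (\<Sum>r\<le>d. 2 ^ Suc r * (k choose Suc r) * (d choose r) + 2 * (2 ^ r * (k choose r) * (d choose r)))"
    unfolding Suc c_coeff_Suc_left by (rule sum.cong) (simp_all add: algebra_simps)
  also have "\<dots> = c_coeff a k + 2 * (\<Sum>b\<le>d. c_coeff b k)"
    unfolding Suc c_coeff_Suc_left sum_c_coeff sum.distrib sum_distrib_left ..
  finally show ?thesis by (simp add: Suc lessThan_Suc_atMost)
qed

lemma finite_compositions: "finite (compositions a k)"
proof (rule finite_subset)
  show "compositions a k \<subseteq> {..<k} \<rightarrow>\<^sub>E {..a}"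
  proof
    fix u assume u: "u \<in> compositions a k"
    have "u s \<le> a" if "s < k" for s
      using u member_le_sum[of s "{..<k}" u] that by (auto simp: compositions_def)
    then show "u \<in> {..<k} \<rightarrow>\<^sub>E {..a}" using u by (auto simp: compositions_def)
  qed
qed (simp add: finite_PiE)

text \<open>The formula reflects a choice of \<open>r\<close> nonzero positions and of a composition
  of \<open>a\<close> into \<open>r\<close> positive parts. Splitting off the last part reduces this
  count to the recurrence \<open>c_coeff_Suc_right\<close>.\<close>

lemma c_coeff_eq_sum_compositions:
  "c_coeff a k = (\<Sum>u\<in>compositions a k. 2 ^ card {s \<in> {..<k}. u s \<noteq> 0})"
proof (induction k arbitrary: a)
  case 0
  have "compositions a 0 = (if a = 0 then {\<lambda>_. undefined} else {})"
    by (auto simp: compositions_def)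
  then show ?case by (simp add: c_coeff_def)
next
  case (Suc k)
  let ?w = "\<lambda>k u. (2::nat) ^ card {s \<in> {..<k}. u s \<noteq> (0::nat)}"
  have "(\<Sum>u\<in>compositions a (Suc k). ?w (Suc k) u)
      = (\<Sum>(v, u)\<in>(SIGMA v:{..a}. compositions (a - v) k). (if v = 0 then 1 else 2) * ?w k u)"
  proof (rule sum.reindex_bij_witness[of _ "\<lambda>(v, u). u(k := v)" "\<lambda>u. (u k, restrict u {..<k})"])
    fix u assume u: "u \<in> compositions a (Suc k)"
    have s: "sum (restrict u {..<k}) {..<k} = sum u {..<k}" by (rule sum.cong) auto
    show "(case (u k, restrict u {..<k}) of (v, u) \<Rightarrow> u(k := v)) = u"
      using u by (auto simp: compositions_def fun_eq_iff PiE_def extensional_def)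
    show "(u k, restrict u {..<k}) \<in> (SIGMA v:{..a}. compositions (a - v) k)"
    proof -
      have ku: "sum u {..<k} + u k = a" using u by (simp add: compositions_def)
      then have "restrict u {..<k} \<in> compositions (a - u k) k"
        unfolding compositions_def mem_Collect_eq s by auto
      then show ?thesis using ku by simp
    qed
    have "{s \<in> {..<Suc k}. u s \<noteq> 0} = {s \<in> {..<k}. u s \<noteq> 0} \<union> (if u k = 0 then {} else {k})"
      by (auto simp: less_Suc_eq)
    then have "card {s \<in> {..<Suc k}. u s \<noteq> 0} = card {s \<in> {..<k}. u s \<noteq> 0} + (if u k = 0 then 0 else 1)"
      by auto
    moreover have "{s \<in> {..<k}. restrict u {..<k} s \<noteq> 0} = {s \<in> {..<k}. u s \<noteq> 0}" by auto
    ultimately show "(case (u k, restrict u {..<k}) of (v, u) \<Rightarrow> (if v = 0 then 1 else 2) * ?w k u) = ?w (Suc k) u"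
      by simp
  next
    fix p assume "p \<in> (SIGMA v:{..a}. compositions (a - v) k)"
    then obtain v u where p: "p = (v, u)" "v \<le> a" "u \<in> compositions (a - v) k" by auto
    have s: "sum (u(k := v)) {..<k} = sum u {..<k}" by (rule sum.cong) auto
    show "(case p of (v, u) \<Rightarrow> u(k := v)) \<in> compositions a (Suc k)"
      using p s by (auto simp: compositions_def PiE_def extensional_def)
    show "((case p of (v, u) \<Rightarrow> u(k := v)) k, restrict (case p of (v, u) \<Rightarrow> u(k := v)) {..<k}) = p"
      using p by (auto simp: compositions_def fun_eq_iff PiE_def extensional_def)
  qed
  also have "\<dots> = (\<Sum>v\<le>a. \<Sum>u\<in>compositions (a - v) k. (if v = 0 then 1 else 2) * ?w k u)"
    by (rule sum.Sigma[symmetric]) (auto simp: finite_compositions)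
  also have "\<dots> = (\<Sum>v\<le>a. (if v = 0 then 1 else 2) * c_coeff (a - v) k)"
    by (simp add: Suc sum_distrib_left)
  also have "\<dots> = c_coeff a k + (\<Sum>v<a. 2 * c_coeff (a - Suc v) k)"
    by (simp add: sum.atMost_shift)
  also have "(\<Sum>v<a. 2 * c_coeff (a - Suc v) k) = 2 * (\<Sum>b<a. c_coeff b k)"
    unfolding sum_distrib_left by (rule sum.nat_diff_reindex)
  finally show ?case by (simp add: c_coeff_Suc_right)
qed

section \<open>Copies of left vertices\<close>

definition blowup_edge :: "(nat \<times> 'n) set \<Rightarrow> nat \<times> nat \<Rightarrow> 'n \<Rightarrow> bool" where
  "blowup_edge E l i \<longleftrightarrow> (fst l, i) \<in> E"

abbreviation blowup :: "nat \<Rightarrow> (nat \<Rightarrow> nat) \<Rightarrow> (nat \<times> nat) set" where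
  "blowup m k \<equiv> SIGMA j:{1..m}. {..<k j}"

lemma finite_draconian:
  fixes E :: "(nat \<times> 'n::finite) set"
  shows "finite (draconian m E)"
proof (rule finite_subset)
  show "draconian m E \<subseteq> {1..m} \<rightarrow>\<^sub>E {..CARD('n)}"
  proof
    fix a assume a: "a \<in> draconian m E"
    have "a j \<le> CARD('n)" if "j \<in> {1..m}" for j
    proof -
      have "{j} \<noteq> {} \<and> {j} \<subseteq> {1..m}" using that by blast
      then have "(\<Sum>i\<in>{j}. a i) \<le> card (\<Union>i\<in>{j}. nbhd E i)"
        using a unfolding draconian_def by blast
      also have "\<dots> \<le> CARD('n)" by (intro card_mono) auto
      finally show ?thesis by simp
    qed
    then show "a \<in> {1..m} \<rightarrow>\<^sub>E {..CARD('n)}" using a by (auto simp: draconian_def)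
  qed
qed (simp add: finite_PiE)

text \<open>Copies of a vertex share their neighbours, so among sets of copies with given first
  components the full one yields the strongest inequality, and that is the draconian one.\<close>

lemma hall_vectors_blowup_iff:
  fixes E :: "(nat \<times> 'n::finite) set"
  assumes w: "w \<in> blowup m k \<rightarrow>\<^sub>E UNIV"
  shows "w \<in> hall_vectors (blowup_edge E) (blowup m k) UNIV
     \<longleftrightarrow> (\<lambda>j\<in>{1..m}. \<Sum>s<k j. w (j, s)) \<in> draconian m E" (is "?L \<longleftrightarrow> ?R")
proof -
  define a where "a = (\<lambda>j\<in>{1..m}. \<Sum>s<k j. w (j, s))"
  have sum_a: "(\<Sum>j\<in>J. a j) = sum w (SIGMA j:J. {..<k j})" if J: "J \<subseteq> {1..m}" for J
  proof -
    have "(\<Sum>j\<in>J. a j) = (\<Sum>j\<in>J. \<Sum>s<k j. w (j, s))"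
      by (rule sum.cong) (use J in \<open>auto simp: a_def\<close>)
    also have "\<dots> = sum w (SIGMA j:J. {..<k j})"
      using finite_subset[OF J] by (subst sum.Sigma) auto
    finally show ?thesis .
  qed
  show ?thesis
    unfolding a_def[symmetric]
  proof
    assume L: ?L
    have "(\<Sum>j\<in>J. a j) \<le> card (\<Union>j\<in>J. nbhd E j)" if J: "J \<subseteq> {1..m}" for J
    proof -
      have "(SIGMA j:J. {..<k j}) \<subseteq> blowup m k" using J by auto
      then have "sum w (SIGMA j:J. {..<k j}) \<le> card (neighbours (blowup_edge E) UNIV (SIGMA j:J. {..<k j}))"
        using L by (simp add: hall_vectors_def)
      \<comment> \<open>An inequality only: a vertex with \<open>k j = 0\<close> has no copies and
        contributes no neighbours.\<close>
      also have "\<dots> \<le> card (\<Union>j\<in>J. nbhd E j)"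
        by (rule card_mono) (auto simp: neighbours_def blowup_edge_def nbhd_def)
      finally show ?thesis using sum_a[OF J] by simp
    qed
    then show "a \<in> draconian m E" by (auto simp: draconian_def a_def)
  next
    assume "a \<in> draconian m E"
    then have dr: "\<forall>J. J \<noteq> {} \<and> J \<subseteq> {1..m} \<longrightarrow> (\<Sum>j\<in>J. a j) \<le> card (\<Union>j\<in>J. nbhd E j)"
      unfolding draconian_def mem_Collect_eq by (rule conjunct2)
    have "sum w K \<le> card (neighbours (blowup_edge E) UNIV K)" if K: "K \<subseteq> blowup m k" for K
    proof (cases "K = {}")
      case False
      have J: "fst ` K \<noteq> {} \<and> fst ` K \<subseteq> {1..m}" using K False by auto
      then have "finite (fst ` K)" using finite_subset by blast
      have "sum w K \<le> sum w (SIGMA j:fst ` K. {..<k j})"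
      proof (rule sum_mono2)
        show "K \<subseteq> (SIGMA j:fst ` K. {..<k j})" using K by force
      qed (use \<open>finite (fst ` K)\<close> in auto)
      also have "\<dots> = (\<Sum>j\<in>fst ` K. a j)" using J by (intro sum_a[symmetric]) simp
      also have "\<dots> \<le> card (\<Union>j\<in>fst ` K. nbhd E j)" using dr[rule_format, OF J] .
      also have "(\<Union>j\<in>fst ` K. nbhd E j) = neighbours (blowup_edge E) UNIV K"
        by (auto simp: neighbours_def blowup_edge_def nbhd_def)
      finally show ?thesis .
    qed simp
    then show ?L using w by (simp add: hall_vectors_def)
  qed
qed

text \<open>Choosing a weak composition of every \<open>a j\<close> amounts to a vector on the
  copies, with \<open>a\<close> recovered as its block sums; the weights multiply because the
  support is the disjoint union of the blocks' supports.\<close>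

lemma draconian_sum_eq:
  fixes E :: "(nat \<times> 'n::finite) set"
  shows "(\<Sum>a\<in>draconian m E. \<Prod>j = 1..m. c_coeff (a j) (k j))
    = (\<Sum>w\<in>hall_vectors (blowup_edge E) (blowup m k) UNIV. 2 ^ card {l \<in> blowup m k. w l \<noteq> 0})"
proof -
  define F where "F a = (\<Pi>\<^sub>E j\<in>{1..m}. compositions (a j) (k j))" for a
  define W where "W U = (\<Prod>j = 1..m. (2::nat) ^ card {s \<in> {..<k j}. U j s \<noteq> (0::nat)})" for U :: "nat \<Rightarrow> nat \<Rightarrow> nat"
  define join where "join p = (\<lambda>l\<in>blowup m k. snd p (fst l) (snd l))"
    for p :: "(nat \<Rightarrow> nat) \<times> (nat \<Rightarrow> nat \<Rightarrow> nat)"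
  define split where "split w = (\<lambda>j\<in>{1..m}. \<Sum>s<k j. w (j, s), \<lambda>j\<in>{1..m}. \<lambda>s\<in>{..<k j}. w (j, s))"
    for w :: "nat \<times> nat \<Rightarrow> nat"
  have "(\<Sum>a\<in>draconian m E. \<Prod>j = 1..m. c_coeff (a j) (k j)) = (\<Sum>a\<in>draconian m E. \<Sum>U\<in>F a. W U)"
    unfolding c_coeff_eq_sum_compositions F_def W_def
    by (intro sum.cong refl prod_sum_PiE) (auto simp: finite_compositions)
  also have "\<dots> = (\<Sum>p\<in>(SIGMA a:draconian m E. F a). W (snd p))"
    by (subst sum.Sigma)
      (simp_all add: finite_draconian F_def finite_compositions case_prod_beta finite_PiE)
  also have "\<dots> = (\<Sum>w\<in>hall_vectors (blowup_edge E) (blowup m k) UNIV. 2 ^ card {l \<in> blowup m k. w l \<noteq> 0})"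
  proof (rule sum.reindex_bij_witness[of _ split join])
    fix p assume "p \<in> (SIGMA a:draconian m E. F a)"
    then obtain a U where p: "p = (a, U)" and a: "a \<in> draconian m E" and U: "U \<in> F a" by blast
    have Uj: "U j \<in> {..<k j} \<rightarrow>\<^sub>E UNIV" "sum (U j) {..<k j} = a j" if "j \<in> {1..m}" for j
    proof -
      have "U j \<in> compositions (a j) (k j)" using U that unfolding F_def by (rule PiE_mem)
      then show "U j \<in> {..<k j} \<rightarrow>\<^sub>E UNIV" "sum (U j) {..<k j} = a j" by (simp_all add: compositions_def)
    qed
    have val: "join p (j, s) = U j s" if "j \<in> {1..m}" "s < k j" for j s
      using that by (simp add: join_def p)
    have ext: "join p \<in> blowup m k \<rightarrow>\<^sub>E UNIV" by (simp add: join_def)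
    have ea: "(\<lambda>j\<in>{1..m}. \<Sum>s<k j. join p (j, s)) = a"
    proof (rule extensionalityI)
      show "a \<in> extensional {1..m}" using a by (simp add: draconian_def PiE_def)
    qed (use Uj(2) val in auto)
    have eU: "(\<lambda>j\<in>{1..m}. \<lambda>s\<in>{..<k j}. join p (j, s)) = U"
    proof (rule extensionalityI)
      show "U \<in> extensional {1..m}" using U by (simp add: F_def PiE_def)
      fix j assume j: "j \<in> {1..m}"
      have "(\<lambda>s\<in>{..<k j}. join p (j, s)) = U j"
      proof (rule extensionalityI)
        show "U j \<in> extensional {..<k j}" using Uj(1)[OF j] by (simp add: PiE_def)
      qed (use val j in auto)
      then show "(\<lambda>j\<in>{1..m}. \<lambda>s\<in>{..<k j}. join p (j, s)) j = U j" using j by simp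
    qed simp
    have "split (join p) = (a, U)" by (simp only: split_def ea eU)
    then show "split (join p) = p" by (simp only: p)
    show "join p \<in> hall_vectors (blowup_edge E) (blowup m k) UNIV"
      unfolding hall_vectors_blowup_iff[OF ext] ea by (rule a)
    have "{l \<in> blowup m k. join p l \<noteq> 0} = (SIGMA j:{1..m}. {s \<in> {..<k j}. U j s \<noteq> 0})"
      by (auto simp: join_def p)
    then show "2 ^ card {l \<in> blowup m k. join p l \<noteq> 0} = W (snd p)"
      by (simp add: p W_def power_sum)
  next
    fix w assume w: "w \<in> hall_vectors (blowup_edge E) (blowup m k) UNIV"
    then have wE: "w \<in> blowup m k \<rightarrow>\<^sub>E UNIV" by (simp add: hall_vectors_def)
    have "(\<lambda>j\<in>{1..m}. \<Sum>s<k j. w (j, s)) \<in> draconian m E"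
      using w unfolding hall_vectors_blowup_iff[OF wE] .
    moreover have "(\<lambda>j\<in>{1..m}. \<lambda>s\<in>{..<k j}. w (j, s)) \<in> F (\<lambda>j\<in>{1..m}. \<Sum>s<k j. w (j, s))"
      unfolding F_def by (rule PiE_I) (auto simp: compositions_def)
    ultimately show "split w \<in> (SIGMA a:draconian m E. F a)" unfolding split_def by (intro SigmaI)
    show "join (split w) = w"
    proof (rule extensionalityI)
      show "w \<in> extensional (blowup m k)" using wE by (simp add: PiE_def)
      show "join (split w) l = w l" if "l \<in> blowup m k" for l
        using that by (cases l) (simp add: join_def split_def)
    qed (simp add: join_def)
  qed
  finally show ?thesis .
qed

section \<open>Lattice points of the polytope\<close>

text \<open>Integer decomposition. When the left vertex \<open>l\<close> is removed, each Hall condition fails by at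
  most one; the failing sets are closed under intersection by submodularity, so the smallest one
  contains a vertex that \<open>l\<close> can serve and that repairs all of them.\<close>

lemma hall_vector_realizable:
  fixes y :: "'r \<Rightarrow> nat"
  assumes "finite L" "finite R" "y \<in> hall_vectors F R L"
  shows "\<exists>\<phi>. (\<forall>l\<in>L. \<forall>i. \<phi> l = Some i \<longrightarrow> i \<in> R \<and> F i l) \<and>
             (\<forall>i\<in>R. y i = card {l \<in> L. \<phi> l = Some i})"
  using assms(1,3)
proof (induction L arbitrary: y rule: finite_induct)
  case empty
  have "y i = 0" if "i \<in> R" for i
  proof -
    have "sum y {i} \<le> card (neighbours F {} {i})" using empty that unfolding hall_vectors_def by blast
    then show ?thesis by (simp add: neighbours_def)
  qed
  then show ?case by auto
next
  case (insert l L)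
  let ?f = "\<lambda>S. card (neighbours F L S)"
  have yE: "y \<in> R \<rightarrow>\<^sub>E UNIV" using insert.prems by (simp add: hall_vectors_def)
  have finS: "finite S" if "S \<subseteq> R" for S using that assms(2) finite_subset by blast
  have nb_insert: "neighbours F (insert l L) S = neighbours F L S \<union> (if \<exists>i\<in>S. F i l then {l} else {})" for S
    by (auto simp: neighbours_def)
  have upper: "sum y S \<le> ?f S + (if \<exists>i\<in>S. F i l then 1 else 0)" if S: "S \<subseteq> R" for S
  proof -
    have "sum y S \<le> card (neighbours F (insert l L) S)"
      using insert.prems S by (simp add: hall_vectors_def)
    also have "\<dots> \<le> ?f S + card (if \<exists>i\<in>S. F i l then {l} else {})"
      unfolding nb_insert by (rule card_Un_le)
    finally show ?thesis by (cases "\<exists>i\<in>S. F i l") auto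
  qed
  show ?case
  proof (cases "y \<in> hall_vectors F R L")
    case True
    from insert.IH[OF True] obtain \<phi> where \<phi>: "\<forall>l\<in>L. \<forall>i. \<phi> l = Some i \<longrightarrow> i \<in> R \<and> F i l"
      "\<forall>i\<in>R. y i = card {l \<in> L. \<phi> l = Some i}" by blast
    have "{l' \<in> insert l L. (\<phi>(l := None)) l' = Some i} = {l \<in> L. \<phi> l = Some i}" for i
      using insert.hyps by auto
    then show ?thesis using \<phi> by (intro exI[of _ "\<phi>(l := None)"]) auto
  next
    case False
    define Viol where "Viol = {S. S \<subseteq> R \<and> ?f S < sum y S}"
    have "Viol \<noteq> {}" using False yE by (auto simp: Viol_def hall_vectors_def not_le)
    then obtain S1 where "S1 \<in> Viol" by blast
    from ex_has_least_nat[of "\<lambda>S. S \<in> Viol", OF this, of card]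
    obtain S0 where S0: "S0 \<in> Viol" and min: "\<And>S. S \<in> Viol \<Longrightarrow> card S0 \<le> card S" by blast
    have S0R: "S0 \<subseteq> R" using S0 by (simp add: Viol_def)
    have sub: "S0 \<subseteq> S" if S: "S \<in> Viol" for S
    proof -
      have SR: "S \<subseteq> R" using S by (simp add: Viol_def)
      have "?f (S \<inter> S0) \<le> card (neighbours F L S \<inter> neighbours F L S0)"
        using insert.hyps by (intro card_mono) (auto simp: neighbours_def)
      moreover have "neighbours F L (S \<union> S0) = neighbours F L S \<union> neighbours F L S0"
        by (auto simp: neighbours_def)
      moreover have "card (neighbours F L S) + card (neighbours F L S0) =
          card (neighbours F L S \<union> neighbours F L S0) + card (neighbours F L S \<inter> neighbours F L S0)"
        using insert.hyps by (intro card_Un_Int) auto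
      moreover have "sum y S + sum y S0 = sum y (S \<union> S0) + sum y (S \<inter> S0)"
        using sum.union_inter[OF finS[OF SR] finS[OF S0R]] by metis
      \<comment> \<open>Two violations give an excess of at least 2, of which the union absorbs at
        most 1; the rest falls on the intersection.\<close>
      moreover have "sum y (S \<union> S0) \<le> ?f (S \<union> S0) + 1"
        using upper[of "S \<union> S0"] SR S0R by (simp split: if_splits)
      ultimately have "?f (S \<inter> S0) < sum y (S \<inter> S0)"
        using S S0 by (simp add: Viol_def)
      then have "S \<inter> S0 \<in> Viol" using SR by (auto simp: Viol_def)
      from min[OF this] have "S \<inter> S0 = S0"
        using card_seteq[OF finS[OF S0R], of "S \<inter> S0"] by blast
      then show ?thesis by blast
    qed
    have "\<exists>i\<in>S0. F i l" using upper[OF S0R] S0 by (auto simp: Viol_def split: if_splits)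
    then obtain i where i: "i \<in> S0" "F i l" by blast
    have iR: "i \<in> R" using i S0R by blast
    \<comment> \<open>With a zero entry at \<open>i\<close>, removing \<open>i\<close> would leave a
      smaller violated set.\<close>
    have ypos: "y i > 0"
    proof (rule ccontr)
      assume "\<not> 0 < y i"
      then have "sum y (S0 - {i}) = sum y S0" using finS[OF S0R] i by (simp add: sum_diff1_nat)
      moreover have "?f (S0 - {i}) \<le> ?f S0"
        using insert.hyps by (intro card_mono) (auto simp: neighbours_def)
      ultimately have "S0 - {i} \<in> Viol" using S0 by (auto simp: Viol_def)
      from sub[OF this] show False using i by blast
    qed
    define y' where "y' = y(i := y i - 1)"
    have "y' \<in> hall_vectors F R L"
      unfolding hall_vectors_def
    proof (intro CollectI conjI allI impI)
      show "y' \<in> R \<rightarrow>\<^sub>E UNIV" using yE iR by (auto simp: y'_def PiE_def extensional_def)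
      fix S assume S: "S \<subseteq> R"
      show "sum y' S \<le> ?f S"
      proof (cases "i \<in> S")
        case True
        have "sum y' (S - {i}) = sum y (S - {i})" by (rule sum.cong) (auto simp: y'_def)
        then have "sum y' S + 1 = sum y S"
          using ypos sum.remove[OF finS[OF S] True, of y] sum.remove[OF finS[OF S] True, of y']
          by (simp add: y'_def)
        moreover have "sum y S \<le> ?f S + 1" using upper[OF S] by (simp split: if_splits)
        ultimately show ?thesis by linarith
      next
        case False
        then have "S \<notin> Viol" using sub i by blast
        moreover have "sum y' S = sum y S" by (rule sum.cong) (use False in \<open>auto simp: y'_def\<close>)
        ultimately show ?thesis using S by (simp add: Viol_def)
      qed
    qed
    from insert.IH[OF this] obtain \<phi> where \<phi>: "\<forall>l\<in>L. \<forall>i. \<phi> l = Some i \<longrightarrow> i \<in> R \<and> F i l"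
      "\<forall>i\<in>R. y' i = card {l \<in> L. \<phi> l = Some i}" by blast
    have "y i' = card {l' \<in> insert l L. (\<phi>(l := Some i)) l' = Some i'}" if i': "i' \<in> R" for i'
    proof -
      have "{l' \<in> insert l L. (\<phi>(l := Some i)) l' = Some i'}
          = (if i' = i then insert l {l \<in> L. \<phi> l = Some i'} else {l \<in> L. \<phi> l = Some i'})"
        using insert.hyps by auto
      then show ?thesis using \<phi>(2) i' insert.hyps ypos by (auto simp: y'_def split: if_splits)
    qed
    then show ?thesis using \<phi>(1) i iR by (intro exI[of _ "\<phi>(l := Some i)"]) auto
  qed
qed

section \<open>Cross polytopes and their Minkowski sums\<close>

lemma zero_in_cross_polytope: "0 \<in> cross_polytope I"
proof (cases "I = {}")
  case False
  then obtain i where i: "i \<in> I" by blast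
  let ?C = "convex hull ((\<lambda>i. axis i (1::real)) ` I \<union> (\<lambda>i. - axis i 1) ` I)"
  have "axis i 1 \<in> ?C" "- axis i 1 \<in> ?C" using i by (auto intro: hull_inc)
  then have "(1/2) *\<^sub>R axis i 1 + (1/2) *\<^sub>R (- axis i 1) \<in> ?C"
    by (intro convexD[OF convex_convex_hull]) auto
  then show ?thesis using False by (simp add: cross_polytope_def)
qed (simp add: cross_polytope_def)

lemma convex_cross_polytope: "convex (cross_polytope I)"
  by (simp add: cross_polytope_def)

lemma axis_in_cross_polytope:
  assumes "i \<in> I" "\<bar>s\<bar> = 1"
  shows "s *\<^sub>R axis i 1 \<in> cross_polytope I"
proof -
  have "s = 1 \<or> s = -1" using assms by linarith
  then show ?thesis using assms(1) by (auto simp: cross_polytope_def intro!: hull_inc)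
qed

text \<open>The sum of absolute values over \<open>S\<close> is a convex function, so a bound on the
  generators passes to their hull. Scaled and added over \<open>j\<close>, these bounds become the
  Hall inequalities for points of \<open>Q_polytope\<close>.\<close>

lemma cross_polytope_sum_le:
  assumes "x \<in> cross_polytope I"
  shows "(\<Sum>i\<in>S. \<bar>x $ i\<bar>) \<le> (if I \<inter> S = {} then 0 else 1)"
proof (cases "I = {}")
  case True
  then show ?thesis using assms by (simp add: cross_polytope_def)
next
  case False
  let ?c = "if I \<inter> S = {} then 0 else 1 :: real"
  let ?D = "{x :: real ^ 'a. (\<Sum>i\<in>S. \<bar>x $ i\<bar>) \<le> ?c}"
  have "convex ?D"
  proof (rule convexI)
    fix x y :: "real ^ 'a" and u v :: real
    assume xy: "x \<in> ?D" "y \<in> ?D" and uv: "0 \<le> u" "0 \<le> v" "u + v = 1"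
    have "(\<Sum>i\<in>S. \<bar>(u *\<^sub>R x + v *\<^sub>R y) $ i\<bar>) \<le> (\<Sum>i\<in>S. u * \<bar>x $ i\<bar> + v * \<bar>y $ i\<bar>)"
    proof (rule sum_mono)
      fix i
      have "\<bar>u * x $ i + v * y $ i\<bar> \<le> \<bar>u * x $ i\<bar> + \<bar>v * y $ i\<bar>" by (rule abs_triangle_ineq)
      then show "\<bar>(u *\<^sub>R x + v *\<^sub>R y) $ i\<bar> \<le> u * \<bar>x $ i\<bar> + v * \<bar>y $ i\<bar>"
        using uv by (simp add: abs_mult)
    qed
    also have "\<dots> = u * (\<Sum>i\<in>S. \<bar>x $ i\<bar>) + v * (\<Sum>i\<in>S. \<bar>y $ i\<bar>)"
      by (simp add: sum.distrib sum_distrib_left)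
    also have "\<dots> \<le> u * ?c + v * ?c" using xy uv by (intro add_mono mult_left_mono) auto
    also have "\<dots> = ?c" using uv by (simp flip: distrib_right)
    finally show "u *\<^sub>R x + v *\<^sub>R y \<in> ?D" by simp
  qed
  moreover have "(\<lambda>i. axis i (1::real)) ` I \<union> (\<lambda>i. - axis i 1) ` I \<subseteq> ?D"
  proof -
    have ax: "(\<Sum>i\<in>S. \<bar>axis i0 (1::real) $ i\<bar>) = (if i0 \<in> S then 1 else 0)" for i0
    proof -
      have "(\<Sum>i\<in>S. \<bar>axis i0 (1::real) $ i\<bar>) = (\<Sum>i\<in>S. if i = i0 then 1 else 0)"
        by (rule sum.cong) (auto simp: axis_def)
      then show ?thesis by simp
    qed
    show ?thesis by (auto simp: ax)
  qed
  ultimately have "cross_polytope I \<subseteq> ?D"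
    using False unfolding cross_polytope_def by (simp add: hull_minimal)
  then show ?thesis using assms by blast
qed

lemma sum_in_scaled_convex:
  fixes f :: "nat \<Rightarrow> 'a::real_vector"
  assumes "convex C" "C \<noteq> {}" "\<And>s. s < k \<Longrightarrow> f s \<in> C"
  shows "(\<Sum>s<k. f s) \<in> (\<lambda>x. real k *\<^sub>R x) ` C"
proof (cases "k = 0")
  case True
  then show ?thesis using assms(2) by auto
next
  case False
  have "(\<Sum>s<k. (1 / real k) *\<^sub>R f s) \<in> C"
    by (rule convex_sum) (use assms False in auto)
  moreover have "(\<Sum>s<k. f s) = real k *\<^sub>R (\<Sum>s<k. (1 / real k) *\<^sub>R f s)"
    using False by (simp flip: scaleR_sum_right)
  ultimately show ?thesis by blast
qed

lemma card_neighbours_blowup: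
  "card (neighbours (\<lambda>i l. blowup_edge E l i) (blowup m k) S)
     = (\<Sum>j = 1..m. if nbhd E j \<inter> S = {} then 0 else k j)"
proof -
  have "neighbours (\<lambda>i l. blowup_edge E l i) (blowup m k) S
      = (SIGMA j:{1..m}. if nbhd E j \<inter> S = {} then {} else {..<k j})"
    by (auto simp: neighbours_def blowup_edge_def nbhd_def split: if_splits)
  then show ?thesis by (simp add: if_distrib cong: if_cong)
qed

lemma Q_polytope_sum_le:
  assumes "x \<in> Q_polytope m E k"
  shows "(\<Sum>i\<in>S. \<bar>x $ i\<bar>) \<le> card (neighbours (\<lambda>i l. blowup_edge E l i) (blowup m k) S)"
proof -
  obtain v where x: "x = (\<Sum>j = 1..m. v j)"
    and "\<forall>j\<in>{1..m}. v j \<in> (\<lambda>x. real (k j) *\<^sub>R x) ` cross_polytope (nbhd E j)"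
    using assms unfolding Q_polytope_def by (subst (asm) set_sum_alt) auto
  then have "\<forall>j\<in>{1..m}. \<exists>u. u \<in> cross_polytope (nbhd E j) \<and> v j = real (k j) *\<^sub>R u" by blast
  then obtain u where u: "\<And>j. j \<in> {1..m} \<Longrightarrow> u j \<in> cross_polytope (nbhd E j)"
    "\<And>j. j \<in> {1..m} \<Longrightarrow> v j = real (k j) *\<^sub>R u j" by metis
  have "(\<Sum>i\<in>S. \<bar>x $ i\<bar>) \<le> (\<Sum>i\<in>S. \<Sum>j = 1..m. \<bar>v j $ i\<bar>)"
    unfolding x sum_component by (intro sum_mono sum_abs)
  also have "\<dots> = (\<Sum>j = 1..m. \<Sum>i\<in>S. \<bar>v j $ i\<bar>)" by (rule sum.swap)
  also have "\<dots> \<le> (\<Sum>j = 1..m. real (if nbhd E j \<inter> S = {} then 0 else k j))"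
  proof (rule sum_mono)
    fix j assume j: "j \<in> {1..m}"
    have "(\<Sum>i\<in>S. \<bar>v j $ i\<bar>) = real (k j) * (\<Sum>i\<in>S. \<bar>u j $ i\<bar>)"
      by (simp add: u(2)[OF j] abs_mult sum_distrib_left)
    also have "\<dots> \<le> real (k j) * (if nbhd E j \<inter> S = {} then 0 else 1)"
      by (intro mult_left_mono cross_polytope_sum_le u(1) j) simp
    finally show "(\<Sum>i\<in>S. \<bar>v j $ i\<bar>) \<le> real (if nbhd E j \<inter> S = {} then 0 else k j)"
      by (simp split: if_splits)
  qed
  also have "\<dots> = card (neighbours (\<lambda>i l. blowup_edge E l i) (blowup m k) S)"
    unfolding card_neighbours_blowup of_nat_sum ..
  finally show ?thesis .
qed

text \<open>Each copy assigned to \<open>i\<close> contributes the unit vector at \<open>i\<close>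
  with the sign of \<open>x $ i\<close>, so these contributions add up to \<open>x $ i\<close>
  without cancellation. The \<open>k j\<close> copies of \<open>j\<close> sum to a point of its
  scaled cross polytope; idle copies contribute 0, which lies in every cross polytope.\<close>

lemma mem_Q_polytope_of_hall_vector:
  fixes x :: "real ^ 'n::finite"
  assumes y: "y \<in> hall_vectors (\<lambda>i l. blowup_edge E l i) UNIV (blowup m k)"
    and xy: "\<And>i. \<bar>x $ i\<bar> = real (y i)"
  shows "x \<in> Q_polytope m E k"
proof -
  have "finite (blowup m k)" by simp
  from hall_vector_realizable[OF this finite y] obtain \<phi>
    where \<phi>: "\<And>l i. l \<in> blowup m k \<Longrightarrow> \<phi> l = Some i \<Longrightarrow> blowup_edge E l i"
      "\<And>i. y i = card {l \<in> blowup m k. \<phi> l = Some i}" by auto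
  define e :: "'n option \<Rightarrow> real ^ 'n" where
    "e q = (case q of None \<Rightarrow> 0 | Some i \<Rightarrow> sgn (x $ i) *\<^sub>R axis i 1)" for q
  define v where "v j = (\<Sum>s<k j. e (\<phi> (j, s)))" for j
  have "e (\<phi> (j, s)) \<in> cross_polytope (nbhd E j)" if js: "j \<in> {1..m}" "s < k j" for j s
  proof (cases "\<phi> (j, s)")
    case None
    then show ?thesis by (simp add: e_def zero_in_cross_polytope)
  next
    case (Some i)
    then have "i \<in> nbhd E j" using \<phi>(1)[of "(j, s)" i] js by (auto simp: blowup_edge_def nbhd_def)
    then show ?thesis using Some zero_in_cross_polytope axis_in_cross_polytope[of i "nbhd E j" "sgn (x $ i)"]
      by (cases "x $ i = 0") (auto simp: e_def abs_sgn_eq)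
  qed
  then have "v j \<in> (\<lambda>x. real (k j) *\<^sub>R x) ` cross_polytope (nbhd E j)" if "j \<in> {1..m}" for j
    unfolding v_def using that
    by (intro sum_in_scaled_convex convex_cross_polytope) (auto intro: zero_in_cross_polytope)
  moreover have "x = (\<Sum>j = 1..m. v j)"
  proof (rule vec_eq_iff[THEN iffD2], rule allI)
    fix i
    have "(\<Sum>j = 1..m. v j) = (\<Sum>l\<in>blowup m k. e (\<phi> l))"
      unfolding v_def by (subst sum.Sigma) auto
    then have "(\<Sum>j = 1..m. v j) $ i = (\<Sum>l\<in>blowup m k. e (\<phi> l) $ i)" by simp
    also have "\<dots> = (\<Sum>l\<in>blowup m k. if \<phi> l = Some i then sgn (x $ i) else 0)"
      by (rule sum.cong) (auto simp: e_def axis_def split: option.splits)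
    also have "\<dots> = (\<Sum>l\<in>{l \<in> blowup m k. \<phi> l = Some i}. sgn (x $ i))"
      by (rule sum.inter_filter[symmetric]) simp
    also have "\<dots> = real (y i) * sgn (x $ i)" using \<phi>(2)[of i] by simp
    also have "\<dots> = x $ i" using xy[of i] by (metis abs_mult_sgn mult.commute)
    finally show "x $ i = (\<Sum>j = 1..m. v j) $ i" ..
  qed
  ultimately show ?thesis unfolding Q_polytope_def by (subst set_sum_alt) auto
qed

text \<open>Each nonzero coordinate has a free sign: the source of the base 2 on the polytope
  side.\<close>

lemma card_vectors_with_abs:
  fixes y :: "'n::finite \<Rightarrow> nat"
  shows "finite {x :: real ^ 'n. \<forall>i. \<bar>x $ i\<bar> = real (y i)}"
    and "card {x :: real ^ 'n. \<forall>i. \<bar>x $ i\<bar> = real (y i)} = 2 ^ card {i \<in> UNIV. y i \<noteq> 0}"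
proof -
  let ?X = "{x :: real ^ 'n. \<forall>i. \<bar>x $ i\<bar> = real (y i)}"
  define Z where "Z i = {z. \<bar>z\<bar> = real (y i)}" for i
  have Z: "Z i = {real (y i), - real (y i)}" for i by (auto simp: Z_def)
  have cZ: "card (Z i) = (if y i \<noteq> 0 then 2 else 1)" for i
  proof (cases "y i = 0")
    case False
    then have "real (y i) \<noteq> - real (y i)" by simp
    then show ?thesis using False by (simp add: Z)
  qed (simp add: Z)
  have bij: "bij_betw vec_nth ?X (Pi\<^sub>E UNIV Z)"
    by (rule bij_betwI[of _ _ _ vec_lambda]) (auto simp: Z_def)
  have "finite (Pi\<^sub>E UNIV Z)" by (rule finite_PiE) (auto simp: Z)
  then show "finite ?X" using bij_betw_finite[OF bij] by simp
  have "card ?X = (\<Prod>i\<in>UNIV. card (Z i))" using bij_betw_same_card[OF bij] by (simp add: card_PiE)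
  also have "\<dots> = (\<Prod>i\<in>UNIV. if y i \<noteq> 0 then 2 else 1)" by (simp only: cZ)
  also have "\<dots> = (\<Prod>i\<in>{i \<in> UNIV. y i \<noteq> 0}. 2)" by (rule prod.inter_filter[symmetric]) simp
  finally show "card ?X = 2 ^ card {i \<in> UNIV. y i \<noteq> 0}" by simp
qed

lemma card_lattice_points_Q_polytope:
  fixes E :: "(nat \<times> 'n::finite) set"
  shows "card (Q_polytope m E k \<inter> integer_points)
    = (\<Sum>y\<in>hall_vectors (\<lambda>i l. blowup_edge E l i) UNIV (blowup m k). 2 ^ card {i \<in> UNIV. y i \<noteq> 0})"
proof -
  let ?H = "hall_vectors (\<lambda>i l. blowup_edge E l i) UNIV (blowup m k) :: ('n \<Rightarrow> nat) set"
  let ?X = "\<lambda>y. {x :: real ^ 'n. \<forall>i. \<bar>x $ i\<bar> = real (y i)}"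
  have "Q_polytope m E k \<inter> integer_points = (\<Union>y\<in>?H. ?X y)"
  proof (intro set_eqI iffI)
    fix x assume x: "x \<in> Q_polytope m E k \<inter> integer_points"
    define y where "y i = nat \<lfloor>\<bar>x $ i\<bar>\<rfloor>" for i
    have xy: "\<bar>x $ i\<bar> = real (y i)" for i
    proof -
      have "x $ i \<in> \<int>" using x by (simp add: integer_points_def)
      then obtain z where "x $ i = of_int z" by (auto elim: Ints_cases)
      then show ?thesis by (simp add: y_def)
    qed
    have "sum y S \<le> card (neighbours (\<lambda>i l. blowup_edge E l i) (blowup m k) S)" for S
    proof -
      have "real (sum y S) = (\<Sum>i\<in>S. \<bar>x $ i\<bar>)" by (simp add: xy)
      also have "\<dots> \<le> card (neighbours (\<lambda>i l. blowup_edge E l i) (blowup m k) S)"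
        using x by (intro Q_polytope_sum_le) simp
      finally show ?thesis by (simp only: of_nat_le_iff)
    qed
    then have "y \<in> ?H" by (simp add: hall_vectors_def)
    then show "x \<in> (\<Union>y\<in>?H. ?X y)" using xy by blast
  next
    fix x assume "x \<in> (\<Union>y\<in>?H. ?X y)"
    then obtain y where y: "y \<in> ?H" and xy: "\<And>i. \<bar>x $ i\<bar> = real (y i)" by blast
    have "x $ i \<in> \<int>" for i
    proof -
      have "\<bar>x $ i\<bar> \<in> \<int>" by (simp add: xy)
      then show ?thesis by (simp add: abs_if split: if_splits)
    qed
    then show "x \<in> Q_polytope m E k \<inter> integer_points"
      using mem_Q_polytope_of_hall_vector[OF y xy] by (simp add: integer_points_def)
  qed
  moreover have "card (\<Union>y\<in>?H. ?X y) = (\<Sum>y\<in>?H. card (?X y))"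
  proof (rule card_UN_disjoint)
    show "finite ?H" by (rule finite_hall_vectors) auto
    show "\<forall>y\<in>?H. \<forall>y'\<in>?H. y \<noteq> y' \<longrightarrow> ?X y \<inter> ?X y' = {}"
    proof (intro ballI impI)
      fix y y' :: "'n \<Rightarrow> nat" assume "y \<noteq> y'"
      then obtain i where "y i \<noteq> y' i" by blast
      then have "\<bar>x $ i\<bar> \<noteq> real (y i) \<or> \<bar>x $ i\<bar> \<noteq> real (y' i)" for x :: "real ^ 'n" by auto
      then show "?X y \<inter> ?X y' = {}" by blast
    qed
  qed (simp add: card_vectors_with_abs)
  ultimately show ?thesis by (simp add: card_vectors_with_abs)
qed

theorem theorem1p4:
  fixes m :: nat and E :: "(nat \<times> 'n::finite) set" and k :: "nat \<Rightarrow> nat"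
  assumes "bipartite_graph m E"
  shows "card (Q_polytope m E k \<inter> integer_points) =
           (\<Sum>a\<in>draconian m E. \<Prod>i = 1..m. c_coeff (a i) (k i))"
  unfolding card_lattice_points_Q_polytope draconian_sum_eq
  using hall_vectors_duality[of "blowup m k" UNIV "\<lambda>n. 2 ^ n" "blowup_edge E"] by simp

end
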